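(* Assume that for every $\theta\in\Theta$ the functions $x\mapsto F_0(x,\theta)$ and $x\mapsto F(x,\theta)$ are $C^1$-regular, as well as the function $x\mapsto a(x,\theta)$. Let $\theta_1,\dots,\theta_N\in\Theta$ and $\mu_N=\sum_{j=1}^N\alpha_j\delta_{\theta_j}$ with $\alpha_j>0$, $\sum_{j=1}^N\alpha_j=1$, and let $\mathcal{F}^N:\mathcal{U}\to\mathbb{R}_+$ be $$\mathcal{F}^N(u)=\int_\Theta a(x_u^\theta(1),\theta)\,d\mu_N(\theta)+\frac{\beta}{2}\|u\|_{L^2}^2=\sum_{j=1}^N\alpha_j\,a(x_u^{\theta_j}(1),\theta_j)+\frac{\beta}{2}\|u\|_{L^2}^2 .$$ Then $\mathcal{F}^N$ is Gateaux differentiable at every $u\in\mathcal{U}$. Let $\mathcal{G}^N:\mathcal{U}\to\mathcal{U}$ be the gradient vector field, i.e. $\langle\mathcal{G}^N[u],v\rangle_{L^2}=d_u\mathcal{F}^N(v)$ for every $u,v\in\mathcal{U}$. Then for every $u\in\mathcal{U}$ $$\mathcal{G}^N[u](t)=\sum_{j=1}^N\alpha_j\,F(x_u^{\theta_j}(t),\theta_j)^T\,\lambda_u^j(t)^T+\beta u(t)\qquad\text{for a.e. }t\in[0,1],$$ where, for every $j=1,\dots,N$, $\lambda_u^j:[0,1]\to(\mathbb{R}^n)^*$ is the absolutely continuous curve of covectors that solves $$\begin{cases}\dot\lambda_u^j(t)=-\lambda_u^j(t)\left(\frac{\partial F_0(x_u^{\theta_j}(t),\theta_j)}{\partial x}+\sum_{i=1}^k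 u_i(t)\frac{\partial F_i(x_u^{\theta_j}(t),\theta_j)}{\partial x}\right)&\text{a.e. in }[0,1],\\ \lambda_u^j(1)=\nabla_x a(x_u^{\theta_j}(1),\theta_j).\end{cases}$$
   Context: Let $n,k,N\ge 1$ and let $\Theta$ be a compact subset of a finite-dimensional Euclidean space. Let $F_0:\mathbb{R}^n\times\Theta\to\mathbb{R}^n$ and $F=(F_1,\dots,F_k):\mathbb{R}^n\times\Theta\to\mathbb{R}^{n\times k}$ ($F_i$ is the $i$-th column of $F$) be such that, for some $L>0$, $|F_i(x_1,\theta_1)-F_i(x_2,\theta_2)|_2\le L(|x_1-x_2|_2+|\theta_1-\theta_2|_2)$ for all $i=0,\dots,k$ and all $(x_1,\theta_1),(x_2,\theta_2)\in\mathbb{R}^n\times\Theta$. Let $x_0:\Theta\to\mathbb{R}^n$ be continuous. Set $\mathcal{U}:=L^2([0,1],\mathbb{R}^k)$ with its usual scalar product. For $u\in\mathcal{U}$ and $\theta\in\Theta$, $x_u^\theta:[0,1]\to\mathbb{R}^n$ is the unique absolutely continuous solution of $\dot x(t)=F_0(x(t),\theta)+F(x(t),\theta)u(t)$ for a.e. $t\in[0,1]$, $x(0)=x_0(\theta)$. The function $a:\mathbb{R}^n\times\Theta\to\mathbb{R}_+$ is continuous and non-negative, $\beta>0$. Elements of $(\mathbb{R}^n)^*$ are row vectors, and $\nabla_x a$ is regarded as a row vector. *)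

theory Defs
  imports "HOL-Analysis.Analysis"
begin

section \<open>The Hilbert space of controls\<close>

definition square_integrable :: "(real \<Rightarrow> real^'k) \<Rightarrow> bool" where
  "square_integrable f \<longleftrightarrow>
     f \<in> borel_measurable (lebesgue_on {0..1}) \<and>
     integrable (lebesgue_on {0..1}) (\<lambda>t. (norm (f t))\<^sup>2)"

definition L2_rel :: "(real \<Rightarrow> real^'k) \<Rightarrow> (real \<Rightarrow> real^'k) \<Rightarrow> bool" where
  "L2_rel f g \<longleftrightarrow> square_integrable f \<and> square_integrable g \<and>
     (AE t in lebesgue_on {0..1}. f t = g t)"

lemma square_integrable_inner:
  assumes "square_integrable f" "square_integrable g"
  shows "integrable (lebesgue_on {0..1}) (\<lambda>t. f t \<bullet> g t)"
proof (rule Bochner_Integration.integrable_bound)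
  show "integrable (lebesgue_on {0..1}) (\<lambda>t. (norm (f t))\<^sup>2 + (norm (g t))\<^sup>2)"
    using assms by (auto simp: square_integrable_def)
  show "(\<lambda>t. f t \<bullet> g t) \<in> borel_measurable (lebesgue_on {0..1})"
    using assms by (auto simp: square_integrable_def)
  have "norm (x \<bullet> y) \<le> norm ((norm x)\<^sup>2 + (norm y)\<^sup>2)" for x y :: "real^'a"
  proof -
    have "\<bar>x \<bullet> y\<bar> \<le> norm x * norm y"
      by (rule Cauchy_Schwarz_ineq2)
    moreover have "2 * (norm x * norm y) \<le> (norm x)\<^sup>2 + (norm y)\<^sup>2"
      using sum_squares_bound[of "norm x" "norm y"] by (simp add: mult.assoc)
    moreover have "0 \<le> norm x * norm y"
      by simp
    ultimately show ?thesis
      by simp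
  qed
  then show "AE t in lebesgue_on {0..1}. norm (f t \<bullet> g t) \<le> norm ((norm (f t))\<^sup>2 + (norm (g t))\<^sup>2)"
    by simp
qed

lemma square_integrable_0: "square_integrable (\<lambda>t. 0)"
  by (simp add: square_integrable_def)

lemma square_integrable_scaleR:
  assumes "square_integrable f"
  shows "square_integrable (\<lambda>t. c *\<^sub>R f t)"
  using assms by (auto simp: square_integrable_def power_mult_distrib)

lemma square_integrable_add:
  assumes "square_integrable f" "square_integrable g"
  shows "square_integrable (\<lambda>t. f t + g t)"
proof -
  have "(norm (f t + g t))\<^sup>2 = (norm (f t))\<^sup>2 + (norm (g t))\<^sup>2 + 2 * (f t \<bullet> g t)" for t
    by (simp add: power2_norm_eq_inner inner_add_left inner_add_right inner_commute)
  then show ?thesis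
    using assms square_integrable_inner[OF assms] by (auto simp: square_integrable_def)
qed

text \<open>\<open>'k L2\<close> is $L^2([0,1],\mathbb{R}^k)$, with \<open>k = CARD('k)\<close>. For a class \<open>u\<close>,
  \<open>rep_L2 u\<close> is some representative of it, determined only up to a null set.\<close>

quotient_type 'k L2 = "real \<Rightarrow> real^'k" / partial: L2_rel
proof (rule part_equivpI)
  show "\<exists>f. L2_rel f f"
    by (rule exI[of _ "\<lambda>t. 0"]) (simp add: L2_rel_def square_integrable_0)
  show "symp L2_rel"
    by (auto simp: symp_def L2_rel_def)
  show "transp L2_rel"
    by (auto simp: transp_def L2_rel_def)
qed

instantiation L2 :: (finite) real_inner
begin

lift_definition zero_L2 :: "'a L2" is "\<lambda>t. 0"
  by (simp add: L2_rel_def square_integrable_0)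

lift_definition plus_L2 :: "'a L2 \<Rightarrow> 'a L2 \<Rightarrow> 'a L2" is "\<lambda>f g t. f t + g t"
  by (auto simp: L2_rel_def square_integrable_add)

lift_definition scaleR_L2 :: "real \<Rightarrow> 'a L2 \<Rightarrow> 'a L2" is "\<lambda>c f t. c *\<^sub>R f t"
  by (auto simp: L2_rel_def square_integrable_scaleR)

definition uminus_L2_def:
  "- (u :: 'a L2) = (-1) *\<^sub>R u"

definition minus_L2_def:
  "u - (v :: 'a L2) = u + (- v)"

lift_definition inner_L2 :: "'a L2 \<Rightarrow> 'a L2 \<Rightarrow> real"
  is "\<lambda>f g. LINT t|lebesgue_on {0..1}. f t \<bullet> g t"
  by (rule integral_cong_AE) (auto simp: L2_rel_def square_integrable_def)

definition norm_L2_def: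
  "norm (u :: 'a L2) = sqrt (u \<bullet> u)"

definition dist_L2_def:
  "dist u (v :: 'a L2) = norm (u - v)"

definition sgn_L2_def:
  "sgn (u :: 'a L2) = inverse (norm u) *\<^sub>R u"

definition uniformity_L2_def:
  "(uniformity :: ('a L2 \<times> 'a L2) filter) = (INF e\<in>{0<..}. principal {(u, v). dist u v < e})"

definition open_L2_def:
  "open (U :: 'a L2 set) \<longleftrightarrow> (\<forall>u\<in>U. eventually (\<lambda>(u', v). u' = u \<longrightarrow> v \<in> U) uniformity)"

instance
proof
  fix u v w :: "'a L2" and b c :: real
  show add_assoc: "u + v + w = u + (v + w)" for u v w :: "'a L2"
    by transfer (auto simp: L2_rel_def add.assoc intro!: square_integrable_add)
  show "u + v = v + u"
    by transfer (auto simp: L2_rel_def add.commute intro!: square_integrable_add)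
  show "0 + u = u"
    by transfer (auto simp: L2_rel_def)
  show "- u + u = 0"
    unfolding uminus_L2_def
    by transfer (auto simp: L2_rel_def square_integrable_def)
  show "u - v = u + - v"
    by (rule minus_L2_def)
  show "c *\<^sub>R (u + v) = c *\<^sub>R u + c *\<^sub>R v"
    by transfer (auto simp: L2_rel_def scaleR_add_right
        intro!: square_integrable_add square_integrable_scaleR)
  show "(b + c) *\<^sub>R u = b *\<^sub>R u + c *\<^sub>R u"
    by transfer (auto simp: L2_rel_def scaleR_add_left[symmetric]
        intro!: square_integrable_scaleR)
  show "b *\<^sub>R c *\<^sub>R u = (b * c) *\<^sub>R u"
    by transfer (auto simp: L2_rel_def intro!: square_integrable_scaleR)
  show "1 *\<^sub>R u = u"
    by transfer (auto simp: L2_rel_def)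
  show "u \<bullet> v = v \<bullet> u"
    by transfer (simp add: inner_commute)
  show "(u + v) \<bullet> w = u \<bullet> w + v \<bullet> w"
    by transfer (auto simp: L2_rel_def inner_add_left square_integrable_inner)
  show "(c *\<^sub>R u) \<bullet> v = c * (u \<bullet> v)"
    by transfer simp
  show "0 \<le> u \<bullet> u"
    by transfer simp
  show "u \<bullet> u = 0 \<longleftrightarrow> u = 0"
  proof transfer
    fix f :: "real \<Rightarrow> real^'a"
    assume "L2_rel f f"
    then have f: "square_integrable f"
      by (simp add: L2_rel_def)
    have "(LINT t|lebesgue_on {0..1}. f t \<bullet> f t) = 0 \<longleftrightarrow> (AE t in lebesgue_on {0..1}. f t \<bullet> f t = 0)"
      by (rule integral_nonneg_eq_0_iff_AE[OF square_integrable_inner[OF f f]]) simp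
    then show "(LINT t|lebesgue_on {0..1}. f t \<bullet> f t) = 0 \<longleftrightarrow> L2_rel f (\<lambda>t. 0)"
      by (simp add: L2_rel_def f square_integrable_0)
  qed
qed (simp_all add: norm_L2_def dist_L2_def sgn_L2_def uniformity_L2_def open_L2_def)

end


section \<open>Differentiability\<close>

definition C1_regular :: "('a::real_normed_vector \<Rightarrow> 'b::real_normed_vector) \<Rightarrow> bool" where
  "C1_regular f \<longleftrightarrow> (\<exists>f'. (\<forall>x. (f has_derivative blinfun_apply (f' x)) (at x)) \<and> continuous_on UNIV f')"

definition has_gateaux_derivative ::
    "('a::real_normed_vector \<Rightarrow> real) \<Rightarrow> ('a \<Rightarrow> real) \<Rightarrow> 'a \<Rightarrow> bool" where
  "has_gateaux_derivative J J' u \<longleftrightarrow> bounded_linear J' \<and>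
     (\<forall>v. ((\<lambda>h. (J (u + h *\<^sub>R v) - J u) / h) \<longlongrightarrow> J' v) (at 0))"

definition gateaux_differentiable :: "('a::real_normed_vector \<Rightarrow> real) \<Rightarrow> 'a \<Rightarrow> bool" where
  "gateaux_differentiable J u \<longleftrightarrow> (\<exists>J'. has_gateaux_derivative J J' u)"

definition gateaux_derivative :: "('a::real_normed_vector \<Rightarrow> real) \<Rightarrow> 'a \<Rightarrow> 'a \<Rightarrow> real" where
  "gateaux_derivative J u = (THE J'. has_gateaux_derivative J J' u)"

definition gradient_field :: "('a::real_inner \<Rightarrow> real) \<Rightarrow> ('a \<Rightarrow> 'a) \<Rightarrow> bool" where
  "gradient_field J G \<longleftrightarrow> (\<forall>u v. G u \<bullet> v = gateaux_derivative J u v)"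


section \<open>The controlled systems\<close>

text \<open>A division of a subset of \<open>{0..1}\<close> is a finite family of non-overlapping compact intervals.\<close>

definition absolutely_continuous_curve :: "(real \<Rightarrow> 'a::real_normed_vector) \<Rightarrow> bool" where
  "absolutely_continuous_curve x \<longleftrightarrow>
     (\<forall>\<epsilon>>0. \<exists>\<delta>>0. \<forall>D T. D division_of T \<and> T \<subseteq> {0..1} \<and> (\<Sum>K\<in>D. Sup K - Inf K) < \<delta>
        \<longrightarrow> (\<Sum>K\<in>D. norm (x (Sup K) - x (Inf K))) < \<epsilon>)"

text \<open>Curves on $[0,1]$ are functions of a real variable that take a fixed default value outside
  \<open>{0..1}\<close> (\<^const>\<open>extensional\<close>), so that uniqueness of a solution means equality of functions.
  At \<open>x\<close>, the matrix \<open>F x \<theta>\<close> has the controlled fields \<open>column i (F x \<theta>)\<close> as columns.\<close>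

definition is_trajectory ::
    "(real^'n \<Rightarrow> 'p \<Rightarrow> real^'n) \<Rightarrow> (real^'n \<Rightarrow> 'p \<Rightarrow> real^'k^'n) \<Rightarrow> ('p \<Rightarrow> real^'n) \<Rightarrow>
     'p \<Rightarrow> 'k L2 \<Rightarrow> (real \<Rightarrow> real^'n) \<Rightarrow> bool" where
  "is_trajectory F0 F x0 \<theta> u x \<longleftrightarrow>
     x \<in> extensional {0..1} \<and>
     absolutely_continuous_curve x \<and>
     (AE t in lebesgue_on {0..1}.
        (x has_vector_derivative F0 (x t) \<theta> + F (x t) \<theta> *v rep_L2 u t) (at t within {0..1})) \<and>
     x 0 = x0 \<theta>"

definition trajectory ::
    "(real^'n \<Rightarrow> 'p \<Rightarrow> real^'n) \<Rightarrow> (real^'n \<Rightarrow> 'p \<Rightarrow> real^'k^'n) \<Rightarrow> ('p \<Rightarrow> real^'n) \<Rightarrow>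
     'p \<Rightarrow> 'k L2 \<Rightarrow> real \<Rightarrow> real^'n" where
  "trajectory F0 F x0 \<theta> u = (THE x. is_trajectory F0 F x0 \<theta> u x)"

text \<open>Covectors are row vectors: they multiply matrices from the left, by \<open>v*\<close>.\<close>

definition is_adjoint_curve ::
    "(real^'n \<Rightarrow> 'p \<Rightarrow> real^'n) \<Rightarrow> (real^'n \<Rightarrow> 'p \<Rightarrow> real^'k^'n) \<Rightarrow> ('p \<Rightarrow> real^'n) \<Rightarrow>
     (real^'n \<Rightarrow> 'p \<Rightarrow> real) \<Rightarrow> 'p \<Rightarrow> 'k L2 \<Rightarrow> (real \<Rightarrow> real^'n) \<Rightarrow> bool" where
  "is_adjoint_curve F0 F x0 a \<theta> u p \<longleftrightarrow>
     (let x = trajectory F0 F x0 \<theta> u in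
       p \<in> extensional {0..1} \<and>
       absolutely_continuous_curve p \<and>
       (AE t in lebesgue_on {0..1}.
          (p has_vector_derivative
             - (p t v* (jacobian (\<lambda>y. F0 y \<theta>) (at (x t)) +
                 (\<Sum>i\<in>UNIV. (rep_L2 u t $ i) *\<^sub>R jacobian (\<lambda>y. column i (F y \<theta>)) (at (x t))))))
          (at t within {0..1})) \<and>
       GDERIV (\<lambda>y. a y \<theta>) (x 1) :> p 1)"

definition adjoint_curve ::
    "(real^'n \<Rightarrow> 'p \<Rightarrow> real^'n) \<Rightarrow> (real^'n \<Rightarrow> 'p \<Rightarrow> real^'k^'n) \<Rightarrow> ('p \<Rightarrow> real^'n) \<Rightarrow>
     (real^'n \<Rightarrow> 'p \<Rightarrow> real) \<Rightarrow> 'p \<Rightarrow> 'k L2 \<Rightarrow> real \<Rightarrow> real^'n" where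
  "adjoint_curve F0 F x0 a \<theta> u = (THE p. is_adjoint_curve F0 F x0 a \<theta> u p)"


section \<open>The cost functional\<close>

text \<open>The measure $\sum_{j=1}^N \alpha_j \delta_{\theta_j}$ on the Borel subsets of \<open>\<Theta>\<close>.\<close>

definition empirical_measure ::
    "'p::topological_space set \<Rightarrow> nat \<Rightarrow> (nat \<Rightarrow> real) \<Rightarrow> (nat \<Rightarrow> 'p) \<Rightarrow> 'p measure" where
  "empirical_measure \<Theta> N \<alpha> \<theta> =
     measure_of \<Theta> (sets (restrict_space borel \<Theta>))
       (\<lambda>A. \<Sum>j=1..N. ennreal (\<alpha> j) * indicator A (\<theta> j))"

definition ensemble_cost ::
    "(real^'n \<Rightarrow> 'p \<Rightarrow> real^'n) \<Rightarrow> (real^'n \<Rightarrow> 'p \<Rightarrow> real^'k^'n) \<Rightarrow> ('p \<Rightarrow> real^'n) \<Rightarrow>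
     (real^'n \<Rightarrow> 'p \<Rightarrow> real) \<Rightarrow> real \<Rightarrow> 'p measure \<Rightarrow> 'k L2 \<Rightarrow> real" where
  "ensemble_cost F0 F x0 a \<beta> \<mu> u =
     (\<integral>\<theta>. a (trajectory F0 F x0 \<theta> u 1) \<theta> \<partial>\<mu>) + \<beta> / 2 * (norm u)\<^sup>2"

end

theory Submission
  imports Defs
begin

text \<open>
  Along a fixed control the state equation is a Lipschitz equation with integrable Lipschitz constant
  \<open>m\<close>; on the space of curves weighted by $\exp(-2\int_0^t m)$ the Picard operator contracts by the
  factor 1/2, and the same weight yields a Gronwall inequality. Hence trajectories and adjoint curves
  exist, and $|x_{u+hv} - x_u| \le C|h|$ uniformly on $[0,1]$.

  The derivative of the cost needs no linearized flow. With $d_h = x_{u+hv} - x_u$ and the adjoint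
  curve $\lambda$, the terms of first order in $d_h$ cancel in the derivative of $\lambda \cdot d_h$, which
  is $h\,\lambda F(x_{u+hv})v$ plus $\lambda$ applied to the first-order Taylor remainders of
  $F_0$ and $F$. Integrating over $[0,1]$, dividing by $h$ and passing to the limit by dominated
  convergence gives $\nabla_x a \cdot d_h(1)/h \to \int_0^1 \lambda F(x_u) v$.
\<close>

section \<open>Absolutely continuous curves\<close>

text \<open>Controls are classes of square-integrable functions, so velocities may be unbounded in
  time and are defined up to null sets. Every differential equation is therefore traded for its
  integral equation, in which null sets disappear; the trade needs both halves of the fundamental
  theorem of calculus for absolutely continuous curves. The Lipschitz bound is given column by
  column, which makes \<open>L\<close> times one plus the sum of all |u_i(t)| the natural rate; it
  is integrable because L2 lies in L1 on a bounded interval.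

  In the limit the two assumptions on the fields share the work. The Lipschitz bound and the
  estimate by C|h| give an integrable majorant of the Taylor remainders divided by h, uniform in h;
  differentiability at each point of the unperturbed trajectory makes the same quotients vanish
  pointwise. Both trajectories start at the same point, so the pairing with the adjoint curve
  contributes at time 1 only, where the adjoint curve is the gradient of the terminal cost.

  Turning the integral over \<Theta> into a finite sum requires a Borel integrand; it is continuous
  because trajectories depend continuously on the parameter.\<close>

lemma AE_lebesgue_on_iff_negligible:
  assumes "S \<in> sets lebesgue"
  shows "(AE t in lebesgue_on S. P t) \<longleftrightarrow> (\<exists>N. negligible N \<and> (\<forall>t\<in>S - N. P t))"
proof -
  have "(AE t in lebesgue_on S. P t) \<longleftrightarrow> (AE t in lebesgue. t \<in> S \<longrightarrow> P t)"
    using assms by (simp add: AE_restrict_space_iff)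
  also have "\<dots> \<longleftrightarrow> (\<exists>N. negligible N \<and> {t. \<not> (t \<in> S \<longrightarrow> P t)} \<subseteq> N)"
    unfolding eventually_ae_filter_negligible by simp
  also have "\<dots> \<longleftrightarrow> (\<exists>N. negligible N \<and> (\<forall>t\<in>S - N. P t))"
    by (intro ex_cong1 conj_cong) auto
  finally show ?thesis .
qed

text \<open>The pieces of a division come as sets, and absolute continuity reads their end points
  off through \<open>Inf\<close> and \<open>Sup\<close>; degenerate pieces are allowed.\<close>

lemma division_of_subset_cbox_real:
  fixes K :: "real set"
  assumes "D division_of T" "T \<subseteq> {a..b}" "K \<in> D"
  shows "K = {Inf K..Sup K}" "Inf K \<le> Sup K" "a \<le> Inf K" "Sup K \<le> b"
proof -
  obtain c d where K: "K = cbox c d" using division_ofD(4)[OF assms(1,3)] by blast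
  have "K \<noteq> {}" "K \<subseteq> {a..b}"
    using division_ofD(2,3)[OF assms(1,3)] assms(2) by auto
  then show "K = {Inf K..Sup K}" "Inf K \<le> Sup K" "a \<le> Inf K" "Sup K \<le> b"
    using K by auto
qed

text \<open>Absolute continuity asks for a small sum of lengths, whereas an open neighbourhood of a
  null set bounds the measure of a union. This equation joins the two.\<close>

lemma sum_content_division_real:
  fixes T :: "real set"
  assumes "D division_of T" "T \<subseteq> {a..b}"
  shows "(\<Sum>K\<in>D. Sup K - Inf K) = measure lebesgue T"
proof -
  have "measure lebesgue K = Sup K - Inf K" if "K \<in> D" for K
    using division_of_subset_cbox_real[OF assms that]
    by (metis content_real measure_completion sets_lborel borel_closed closed_real_atLeastAtMost)
  then show ?thesis
    using content_division[OF assms(1)] by (simp cong: sum.cong)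
qed

text \<open>Solutions are known to equal an indefinite integral on \<open>{0..1}\<close> only; the
  end points of a division stay in there.\<close>

lemma absolutely_continuous_curve_cong:
  assumes "absolutely_continuous_curve x" "\<And>t. t \<in> {0..1} \<Longrightarrow> x t = y t"
  shows "absolutely_continuous_curve y"
  unfolding absolutely_continuous_curve_def
proof (intro allI impI)
  fix e :: real assume "0 < e"
  then obtain d where "0 < d" and d: "\<And>D T. D division_of T \<and> T \<subseteq> {0..1} \<and> (\<Sum>K\<in>D. Sup K - Inf K) < d
        \<Longrightarrow> (\<Sum>K\<in>D. norm (x (Sup K) - x (Inf K))) < e"
    using assms(1) unfolding absolutely_continuous_curve_def by blast
  show "\<exists>d>0. \<forall>D T. D division_of T \<and> T \<subseteq> {0..1} \<and> (\<Sum>K\<in>D. Sup K - Inf K) < d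
        \<longrightarrow> (\<Sum>K\<in>D. norm (y (Sup K) - y (Inf K))) < e"
  proof (intro exI[of _ d] conjI allI impI)
    fix D T assume DT: "D division_of T \<and> T \<subseteq> {0..1} \<and> (\<Sum>K\<in>D. Sup K - Inf K) < d"
    have "(\<Sum>K\<in>D. norm (y (Sup K) - y (Inf K))) = (\<Sum>K\<in>D. norm (x (Sup K) - x (Inf K)))"
    proof (rule sum.cong[OF refl])
      fix K assume "K \<in> D"
      with DT have "Sup K \<in> {0..1}" "Inf K \<in> {0..1}"
        using division_of_subset_cbox_real[of D T 0 1 K] by auto
      then show "norm (y (Sup K) - y (Inf K)) = norm (x (Sup K) - x (Inf K))"
        using assms(2) by simp
    qed
    with d[OF DT] show "(\<Sum>K\<in>D. norm (y (Sup K) - y (Inf K))) < e" by simp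
  qed fact
qed

lemma absolutely_continuous_curve_imp_continuous_on:
  assumes "absolutely_continuous_curve x"
  shows "continuous_on {0..1} x"
  unfolding continuous_on_iff
proof (intro ballI allI impI)
  fix t e :: real assume t: "t \<in> {0..1}" and "0 < e"
  then obtain d where "0 < d" and d: "\<And>D T. D division_of T \<and> T \<subseteq> {0..1} \<and> (\<Sum>K\<in>D. Sup K - Inf K) < d
        \<Longrightarrow> (\<Sum>K\<in>D. norm (x (Sup K) - x (Inf K))) < e"
    using assms(1) unfolding absolutely_continuous_curve_def by blast
  have *: "norm (x s - x r) < e" if "0 \<le> r" "r \<le> s" "s \<le> 1" "s - r < d" for r s
    using d[of "{{r..s}}" "{r..s}"] that division_of_self[of r s] by auto
  show "\<exists>d>0. \<forall>s\<in>{0..1}. dist s t < d \<longrightarrow> dist (x s) (x t) < e"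
  proof (intro exI[of _ d] conjI ballI impI)
    fix s assume "s \<in> {0..1}" "dist s t < d"
    then show "dist (x s) (x t) < e"
      using *[of s t] *[of t s] t
      by (cases "s \<le> t") (auto simp: dist_norm norm_minus_commute abs_if split: if_splits)
  qed fact
qed

text \<open>A gauge that is fine near the exceptional null set confines the corresponding intervals to a
  small open set, where absolute continuity controls the increments; elsewhere the increments are
  controlled by differentiability.\<close>

lemma absolutely_continuous_curve_has_integral:
  fixes x :: "real \<Rightarrow> 'a::real_normed_vector"
  assumes ac: "absolutely_continuous_curve x"
    and deriv: "AE t in lebesgue_on {0..1}. (x has_vector_derivative g t) (at t within {0..1})"
    and ab: "0 \<le> a" "a \<le> b" "b \<le> 1"
  shows "(g has_integral (x b - x a)) {a..b}"
proof -
  obtain N where N: "negligible N"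
    and D: "\<And>t. t \<in> {0..1} - N \<Longrightarrow> (x has_vector_derivative g t) (at t within {0..1})"
    using deriv by (auto simp: AE_lebesgue_on_iff_negligible)
  \<comment> \<open>At tags in the null set the value 0 removes the Riemann term, so that only the
    increment of \<open>x\<close> is left to be bounded there.\<close>
  define g0 where "g0 = (\<lambda>t. if t \<in> N then 0 else g t)"
  have g0: "(g0 has_integral (x b - x a)) {a..b}"
    unfolding has_integral_real
  proof (intro allI impI)
    fix e :: real assume e: "0 < e"
    then obtain d where "0 < d" and d: "\<And>D T. D division_of T \<and> T \<subseteq> {0..1} \<and> (\<Sum>K\<in>D. Sup K - Inf K) < d
        \<Longrightarrow> (\<Sum>K\<in>D. norm (x (Sup K) - x (Inf K))) < e / 2"
      using ac half_gt_zero[OF e] unfolding absolutely_continuous_curve_def by blast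
    \<comment> \<open>The outer open set bounds the measure of \<open>U - N\<close>; as
      \<open>N\<close> is null, \<open>U\<close> has the same measure.\<close>
    obtain U where U: "open U" "N \<subseteq> U" "U - N \<in> lmeasurable" "emeasure lebesgue (U - N) < ennreal d"
      using sets_lebesgue_outer_open[OF negligible_imp_sets[OF N] \<open>0 < d\<close>] by blast
    have N0: "N \<in> null_sets lebesgue" using N by (simp add: negligible_iff_null_sets)
    have "U = (U - N) \<union> N" using U by blast
    then have "U \<in> lmeasurable"
      using fmeasurable.Un[OF U(3) negligible_imp_measurable[OF N]] by simp
    moreover have "measure lebesgue U = measure lebesgue (U - N)"
      using measure_Diff_null_set[OF fmeasurableD[OF \<open>U \<in> lmeasurable\<close>] N0] by simp
    moreover have "measure lebesgue (U - N) < d"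
      using U(4) \<open>0 < d\<close> by (simp add: U(3) emeasure_eq_measure2 ennreal_less_iff)
    ultimately have mU: "measure lebesgue U < d" by simp
    \<comment> \<open>A quarter of \<open>e\<close> times the total length, at most 1, plus the
      \<open>e / 2\<close> spent on the null set stays below \<open>e\<close>.\<close>
    have "\<exists>r>0. \<forall>y\<in>{0..1}. norm (y - t) < r \<longrightarrow> norm (x y - x t - (y - t) *\<^sub>R g t) \<le> e / 4 * norm (y - t)"
      if "t \<in> {0..1} - N" for t
    proof -
      have "(x has_derivative (\<lambda>h. h *\<^sub>R g t)) (at t within {0..1})"
        using D[OF that] by (simp add: has_vector_derivative_def)
      moreover have "0 < e / 4" using e by simp
      ultimately show ?thesis unfolding has_derivative_within_alt by blast
    qed
    then obtain r where r: "\<And>t. t \<in> {0..1} - N \<Longrightarrow> 0 < r t"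
      and xr: "\<And>t y. t \<in> {0..1} - N \<Longrightarrow> y \<in> {0..1} \<Longrightarrow> norm (y - t) < r t \<Longrightarrow>
            norm (x y - x t - (y - t) *\<^sub>R g t) \<le> e / 4 * norm (y - t)"
      by metis
    \<comment> \<open>Intervals tagged in \<open>N\<close> are forced into \<open>U\<close>, the
      others of \<open>{0..1}\<close> into the range of differentiability; the unit balls complete
      the gauge on the line.\<close>
    define \<gamma> where "\<gamma> = (\<lambda>t. if t \<in> N then U else if t \<in> {0..1} then ball t (r t) else ball t 1)"
    have g: "gauge \<gamma>"
      using U r by (auto simp: gauge_def \<gamma>_def)
    have est: "norm ((\<Sum>(t,K)\<in>p. measure lborel K *\<^sub>R g0 t) - (x b - x a)) < e"
      if p: "p tagged_division_of {a..b}" and fine: "\<gamma> fine p" for p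
    proof -
      note tp = tagged_division_ofD[OF p]
      have Kp: "interior K = {Inf K<..<Sup K} \<and> Inf K \<in> K \<and> Sup K \<in> K \<and> Inf K \<le> t \<and> t \<le> Sup K \<and> 0 \<le> Inf K \<and> Sup K \<le> 1 \<and> measure lborel K = Sup K - Inf K"
        if tK: "(t, K) \<in> p" for t K
      proof -
        obtain c d where K: "K = {c..d}" using tp(4)[OF tK] by auto
        have "t \<in> K" "K \<subseteq> {a..b}" using tp(2,3)[OF tK] by auto
        then show ?thesis using K ab by auto
      qed
      define p1 where "p1 = {(t, K). (t, K) \<in> p \<and> t \<in> N}"
      have fp: "finite p" and p1: "p1 \<subseteq> p" by (use tp(1) in \<open>auto simp: p1_def\<close>)
      have fp1: "finite p1" using finite_subset[OF p1 fp] .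
      have "p tagged_partial_division_of {a..b}"
        using p by (simp add: tagged_division_of_def)
      then have D1: "snd ` p1 division_of \<Union>(snd ` p1)"
        using partial_division_of_tagged_division tagged_partial_division_subset p1 by blast
      have sub1: "\<Union>(snd ` p1) \<subseteq> {0..1}"
      proof -
        have "K \<subseteq> {0..1}" if "(t, K) \<in> p1" for t K
        proof -
          have "(t, K) \<in> p" using that p1 by blast
          from tp(3)[OF this] show ?thesis using ab by force
        qed
        then show ?thesis by fastforce
      qed
      have "\<Union>(snd ` p1) \<subseteq> U"
        proof -
        have "K \<subseteq> U" if "(t, K) \<in> p" "t \<in> N" for t K
          using fineD[OF fine that(1)] that(2) by (simp add: \<gamma>_def)
        then show ?thesis unfolding p1_def by fastforce
      qed
      then have "measure lebesgue (\<Union>(snd ` p1)) \<le> measure lebesgue U"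
        using \<open>U \<in> lmeasurable\<close> fmeasurableD[OF lmeasurable_division[OF D1]] by (intro measure_mono_fmeasurable)
      then have small: "(\<Sum>K\<in>snd ` p1. norm (x (Sup K) - x (Inf K))) < e / 2"
        using d D1 sub1 mU sum_content_division_real[OF D1 sub1] by simp
      \<comment> \<open>One interval may carry two tags. As the pieces do not overlap, it is then a
        single point, and its increment is 0.\<close>
      have "(\<Sum>K\<in>snd ` p1. norm (x (Sup K) - x (Inf K))) = (\<Sum>(t,K)\<in>p1. norm (x (Sup K) - x (Inf K)))"
      proof (subst sum.reindex_nontrivial[OF fp1])
        fix q q' assume q: "q \<in> p1" "q' \<in> p1" "q \<noteq> q'" "snd q = snd q'"
        obtain t t' K where tK: "q = (t, K)" "q' = (t', K)" using q(4) by (metis prod.collapse)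
        have "(t, K) \<in> p" "(t', K) \<in> p" using q p1 tK by auto
        then have "interior K = {}" using tp(5)[of t K t' K] q(3) tK by auto
        moreover have "interior K = {Inf K<..<Sup K}" "Inf K \<le> Sup K"
          using Kp[OF \<open>(t, K) \<in> p\<close>] by auto
        ultimately have "Inf K = Sup K" by simp
        then show "norm (x (Sup (snd q)) - x (Inf (snd q))) = 0" using tK by simp
      qed (simp add: case_prod_unfold o_def)
      with small have s1: "(\<Sum>(t,K)\<in>p1. norm (x (Sup K) - x (Inf K))) < e / 2" by simp
      have s2: "norm (measure lborel K *\<^sub>R g t - (x (Sup K) - x (Inf K))) \<le> e / 4 * measure lborel K"
        if tK: "(t, K) \<in> p - p1" for t K
      proof -
        have K: "Inf K \<in> K" "Sup K \<in> K" "Inf K \<le> t" "t \<le> Sup K" "0 \<le> Inf K" "Sup K \<le> 1" "measure lborel K = Sup K - Inf K"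
          using Kp[of t K] tK by blast+
        have t: "t \<in> {0..1} - N" using tK K(3-6) by (auto simp: p1_def)
        have "K \<subseteq> ball t (r t)" using fineD[OF fine, of t K] tK t by (simp add: \<gamma>_def)
        then have "norm (Inf K - t) < r t" "norm (Sup K - t) < r t"
          using K(1,2) by (auto simp: dist_norm norm_minus_commute subset_iff)
        then have "norm (x (Sup K) - x t - (Sup K - t) *\<^sub>R g t) \<le> e / 4 * norm (Sup K - t)"
            "norm (x (Inf K) - x t - (Inf K - t) *\<^sub>R g t) \<le> e / 4 * norm (Inf K - t)"
          by (intro xr[OF t]; use K(3-6) in simp)+
        \<comment> \<open>The increment over a piece is split at its tag, since differentiability
          compares with the tag only; the two distances add up to the length.\<close>
        moreover have "measure lborel K *\<^sub>R g t - (x (Sup K) - x (Inf K)) =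
            (x (Inf K) - x t - (Inf K - t) *\<^sub>R g t) - (x (Sup K) - x t - (Sup K - t) *\<^sub>R g t)"
          unfolding K(7) by (simp add: algebra_simps)
        ultimately have "norm (measure lborel K *\<^sub>R g t - (x (Sup K) - x (Inf K))) \<le> e / 4 * norm (Inf K - t) + e / 4 * norm (Sup K - t)"
          by (metis norm_triangle_le_diff add_mono)
        also have "\<dots> = e / 4 * (norm (Inf K - t) + norm (Sup K - t))" by (rule distrib_left[symmetric])
        also have "norm (Inf K - t) + norm (Sup K - t) = measure lborel K" using K(3-7) by simp
        finally show ?thesis .
      qed
      have "(\<Sum>(t,K)\<in>p. measure lborel K *\<^sub>R g0 t) - (x b - x a) = (\<Sum>(t,K)\<in>p. measure lborel K *\<^sub>R g0 t - (x (Sup K) - x (Inf K)))"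
        using additive_tagged_division_1[OF ab(2) p, of x] by (simp add: case_prod_unfold sum_subtractf)
      also have "\<dots> = (\<Sum>(t,K)\<in>p1. measure lborel K *\<^sub>R g0 t - (x (Sup K) - x (Inf K)))
            + (\<Sum>(t,K)\<in>p - p1. measure lborel K *\<^sub>R g0 t - (x (Sup K) - x (Inf K)))"
        by (simp add: sum.subset_diff[OF p1 fp] add.commute)
      also have "norm \<dots> \<le> (\<Sum>(t,K)\<in>p1. norm (x (Sup K) - x (Inf K))) + (\<Sum>(t,K)\<in>p - p1. e / 4 * measure lborel K)"
      proof (intro norm_triangle_mono)
        show "norm (\<Sum>(t,K)\<in>p1. measure lborel K *\<^sub>R g0 t - (x (Sup K) - x (Inf K))) \<le> (\<Sum>(t,K)\<in>p1. norm (x (Sup K) - x (Inf K)))"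
        proof (rule sum_norm_le)
          fix q assume q: "q \<in> p1"
          obtain t K where [simp]: "q = (t, K)" by (cases q)
          have "g0 t = 0" using q by (simp add: p1_def g0_def)
          then show "norm (case q of (t, K) \<Rightarrow> measure lborel K *\<^sub>R g0 t - (x (Sup K) - x (Inf K)))
              \<le> (case q of (t, K) \<Rightarrow> norm (x (Sup K) - x (Inf K)))"
            by (simp add: norm_minus_commute)
        qed
        show "norm (\<Sum>(t,K)\<in>p - p1. measure lborel K *\<^sub>R g0 t - (x (Sup K) - x (Inf K))) \<le> (\<Sum>(t,K)\<in>p - p1. e / 4 * measure lborel K)"
        proof (rule sum_norm_le)
          fix q assume q: "q \<in> p - p1"
          obtain t K where [simp]: "q = (t, K)" by (cases q)
          have "g0 t = g t" using q by (auto simp: p1_def g0_def)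
          then show "norm (case q of (t, K) \<Rightarrow> measure lborel K *\<^sub>R g0 t - (x (Sup K) - x (Inf K)))
              \<le> (case q of (t, K) \<Rightarrow> e / 4 * measure lborel K)"
            using s2[of t K] q by simp
        qed
      qed
      also have "(\<Sum>(t,K)\<in>p - p1. e / 4 * measure lborel K) \<le> (\<Sum>(t,K)\<in>p. e / 4 * measure lborel K)"
        by (rule sum_mono2[OF fp]) (use e in auto)
      also have "\<dots> = e / 4 * measure lborel {a..b}"
        using additive_content_tagged_division[of p a b] p
        by (simp add: case_prod_unfold flip: sum_distrib_left sum_divide_distrib)
      also have "\<dots> \<le> e / 4" using ab e by (simp add: mult_left_le)
      finally show ?thesis using s1 e by simp
    qed
    show "\<exists>\<gamma>. gauge \<gamma> \<and> (\<forall>\<D>. \<D> tagged_division_of {a..b} \<and> \<gamma> fine \<D> \<longrightarrow>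
          norm ((\<Sum>(t,K)\<in>\<D>. measure lborel K *\<^sub>R g0 t) - (x b - x a)) < e)"
      using g est by (intro exI[of _ \<gamma>]) simp
  qed
  show ?thesis
    by (rule has_integral_spike[OF N _ g0]) (simp add: g0_def)
qed

section \<open>Absolute continuity of indefinite integrals\<close>

text \<open>The part of \<open>norm (f s)\<close> above the height \<open>n\<close> has small
  integral for large \<open>n\<close>, by dominated convergence. The remaining part is bounded by
  \<open>n\<close>, so its integral is controlled by length alone.\<close>

lemma absolutely_integrable_tail_small:
  fixes f :: "real \<Rightarrow> 'a::euclidean_space"
  assumes f: "f absolutely_integrable_on {a..b}" and "0 < e"
  obtains n :: real where "0 < n" "(\<lambda>s. norm (f s) - min (norm (f s)) n) absolutely_integrable_on {a..b}"
    "integral {a..b} (\<lambda>s. norm (f s) - min (norm (f s)) n) < e"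
proof -
  have nf: "(\<lambda>s. norm (f s)) absolutely_integrable_on {a..b}"
    using absolutely_integrable_norm[OF f] by (simp add: o_def)
  have mn: "(\<lambda>s. norm (f s) - min (norm (f s)) n) absolutely_integrable_on {a..b}" for n :: real
    by (intro set_integral_diff(1) nf absolutely_integrable_min_1 absolutely_integrable_on_const) auto
  have "(\<lambda>k. integral {a..b} (\<lambda>s. norm (f s) - min (norm (f s)) (real k))) \<longlonglongrightarrow> integral {a..b} (\<lambda>s. 0 :: real)"
  proof (rule dominated_convergence(2)[where h = "\<lambda>s. norm (f s)"])
    show "(\<lambda>s. norm (f s) - min (norm (f s)) (real k)) integrable_on {a..b}" for k
      using mn set_lebesgue_integral_eq_integral(1) by blast
    show "(\<lambda>s. norm (f s)) integrable_on {a..b}"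
      using nf set_lebesgue_integral_eq_integral(1) by blast
    show "norm (norm (f s) - min (norm (f s)) (real k)) \<le> norm (f s)" for k s
      by simp
    show "(\<lambda>k. norm (f s) - min (norm (f s)) (real k)) \<longlonglongrightarrow> 0" for s
    proof (rule tendsto_eventually)
      show "\<forall>\<^sub>F k in sequentially. norm (f s) - min (norm (f s)) (real k) = 0"
        using eventually_ge_at_top[of "nat \<lceil>norm (f s)\<rceil>"] by eventually_elim linarith
    qed
  qed
  then have "\<forall>\<^sub>F k in sequentially. integral {a..b} (\<lambda>s. norm (f s) - min (norm (f s)) (real k)) < e"
    using \<open>0 < e\<close> by (intro order_tendstoD) auto
  then obtain k where "0 < k" "integral {a..b} (\<lambda>s. norm (f s) - min (norm (f s)) (real k)) < e"
    using eventually_gt_at_top[of 0] eventually_happens[OF eventually_conj] by (metis (mono_tags, lifting) sequentially_bot)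
  then show ?thesis using that[of "real k"] mn by auto
qed

text \<open>Over a division, the increments are at most the integral of the excess over
  \<open>n\<close> plus \<open>n\<close> times the total length. The length bound
  \<open>e / (2 * n)\<close> leaves half of \<open>e\<close> to each.\<close>

lemma absolutely_continuous_curve_indefinite_integral:
  fixes f :: "real \<Rightarrow> 'a::euclidean_space"
  assumes f: "f absolutely_integrable_on {0..1}"
  shows "absolutely_continuous_curve (\<lambda>t. c + integral {0..t} f)"
  unfolding absolutely_continuous_curve_def
proof (intro allI impI)
  fix e :: real assume "0 < e"
  then have "0 < e / 2" by simp
  then obtain n where "0 < n" and tail: "(\<lambda>s. norm (f s) - min (norm (f s)) n) absolutely_integrable_on {0..1}"
    "integral {0..1} (\<lambda>s. norm (f s) - min (norm (f s)) n) < e / 2"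
    by (rule absolutely_integrable_tail_small[OF f])
  define r where "r = (\<lambda>s. norm (f s) - min (norm (f s)) n)"
  have r0: "0 \<le> r s" and fr: "norm (f s) \<le> r s + n" for s
    by (auto simp: r_def)
  have fi: "f integrable_on {0..1}" and ri: "r integrable_on {0..1}"
    using f tail(1) set_lebesgue_integral_eq_integral(1) unfolding r_def by blast+
  show "\<exists>d>0. \<forall>D T. D division_of T \<and> T \<subseteq> {0..1} \<and> (\<Sum>K\<in>D. Sup K - Inf K) < d \<longrightarrow>
      (\<Sum>K\<in>D. norm (c + integral {0..Sup K} f - (c + integral {0..Inf K} f))) < e"
  proof (intro exI[of _ "e / (2 * n)"] conjI allI impI)
    show "0 < e / (2 * n)" using \<open>0 < e\<close> \<open>0 < n\<close> by simp
    fix D T assume DT: "D division_of T \<and> T \<subseteq> {0..1} \<and> (\<Sum>K\<in>D. Sup K - Inf K) < e / (2 * n)"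
    then have D: "D division_of T" "T \<subseteq> {0..1}" by auto
    have "norm (c + integral {0..Sup K} f - (c + integral {0..Inf K} f)) \<le> integral K r + n * (Sup K - Inf K)"
      if K: "K \<in> D" for K
    proof -
      obtain p q where Kpq: "K = {p..q}" and pq: "0 \<le> p" "p \<le> q" "q \<le> 1"
        using division_of_subset_cbox_real[OF D K] by blast
      have sub: "{p..q} \<subseteq> {0..1}" "{0..q} \<subseteq> {0..1}" using pq by auto
      have "integral {0..p} f + integral {p..q} f = integral {0..q} f"
        using pq sub integrable_on_subinterval[OF fi] by (intro Henstock_Kurzweil_Integration.integral_combine) auto
      then have "norm (c + integral {0..q} f - (c + integral {0..p} f)) = norm (integral {p..q} f)"
        by (metis add_diff_cancel_left add_diff_cancel_left')
      also have "\<dots> \<le> integral {p..q} (\<lambda>s. r s + n)"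
        using integrable_on_subinterval[OF fi sub(1)] integrable_on_subinterval[OF ri sub(1)] fr
        by (intro integral_norm_bound_integral integrable_add) auto
      also have "\<dots> = integral {p..q} r + n * (q - p)"
        using integrable_on_subinterval[OF ri sub(1)] pq by (subst integral_add) auto
      finally show ?thesis using pq Kpq by simp
    qed
    then have "(\<Sum>K\<in>D. norm (c + integral {0..Sup K} f - (c + integral {0..Inf K} f)))
        \<le> (\<Sum>K\<in>D. integral K r) + n * (\<Sum>K\<in>D. Sup K - Inf K)"
      by (simp add: sum_distrib_left flip: sum.distrib) (rule sum_mono)
    also have "(\<Sum>K\<in>D. integral K r) = integral T r"
      using integral_combine_division_topdown[OF integrable_on_subdivision[OF D(1) ri D(2)] D(1)] by simp
    also have "integral T r \<le> integral {0..1} r"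
      using integral_subset_le[OF D(2) integrable_on_subdivision[OF D(1) ri D(2)] ri] r0 by simp
    also have "\<dots> < e / 2" using tail(2) by (simp add: r_def)
    also have "n * (\<Sum>K\<in>D. Sup K - Inf K) \<le> n * (e / (2 * n))"
      using DT \<open>0 < n\<close> by (intro mult_left_mono) auto
    also have "e / 2 + n * (e / (2 * n)) = e" using \<open>0 < n\<close> by (simp add: field_simps)
    finally show "(\<Sum>K\<in>D. norm (c + integral {0..Sup K} f - (c + integral {0..Inf K} f))) < e" by simp
  qed
qed

section \<open>Differentiation of indefinite integrals almost everywhere\<close>

text \<open>Lebesgue differentiation for cubes anchored at a corner is in dimension one a right
  derivative. The error is multiplied by \<open>h\<close> to match the shape of
  \<open>has_derivative_within_alt\<close>.\<close>

lemma AE_right_derivative_indefinite_integral: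
  fixes f :: "real \<Rightarrow> 'a::euclidean_space"
  assumes "\<And>a b. f integrable_on {a..b}"
  shows "\<exists>N. negligible N \<and> (\<forall>t e. t \<notin> N \<longrightarrow> 0 < e \<longrightarrow>
    (\<exists>d>0. \<forall>h. 0 < h \<and> h < d \<longrightarrow> norm (integral {t..t + h} f - h *\<^sub>R f t) \<le> e * h))"
proof -
  obtain N where N: "negligible N"
    "\<And>x e. x \<notin> N \<Longrightarrow> 0 < e \<Longrightarrow> \<exists>d>0. \<forall>h. 0 < h \<and> h < d \<longrightarrow>
        norm (integral (cbox x (x + h *\<^sub>R One)) f /\<^sub>R h ^ DIM(real) - f x) < e"
    by (rule integrable_ccontinuous_explicit[of f]) (use assms in auto)
  show ?thesis
  proof (intro exI[of _ N] conjI allI impI N(1))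
    fix t e :: real assume "t \<notin> N" "0 < e"
    then obtain d where "0 < d" and d: "\<And>h. 0 < h \<Longrightarrow> h < d \<Longrightarrow> norm (integral {t..t + h} f /\<^sub>R h - f t) < e"
      using N(2) by fastforce
    have "norm (integral {t..t + h} f - h *\<^sub>R f t) \<le> e * h" if h: "0 < h" "h < d" for h
    proof -
      have "integral {t..t + h} f - h *\<^sub>R f t = h *\<^sub>R (integral {t..t + h} f /\<^sub>R h - f t)"
        using h by (simp add: scaleR_diff_right)
      then show ?thesis using d[OF h] h by (simp add: mult.commute)
    qed
    with \<open>0 < d\<close> show "\<exists>d>0. \<forall>h. 0 < h \<and> h < d \<longrightarrow> norm (integral {t..t + h} f - h *\<^sub>R f t) \<le> e * h" by blast
  qed
qed

text \<open>The left derivative at \<open>t\<close> comes from the right derivative at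
  \<open>- t\<close> of the reflected function.\<close>

lemma indefinite_integral_has_vector_derivative_AE:
  fixes f :: "real \<Rightarrow> 'a::euclidean_space"
  assumes f: "f integrable_on {a..b}"
  shows "AE t in lebesgue_on {a..b}. ((\<lambda>t. c + integral {a..t} f) has_vector_derivative f t) (at t within {a..b})"
proof -
  \<comment> \<open>Extension by 0 makes the function integrable on every interval, also after
    reflection.\<close>
  define g where "g = (\<lambda>t. if t \<in> {a..b} then f t else 0)"
  have g: "g integrable_on {p..q}" for p q
  proof (rule integrable_on_subinterval)
    show "g integrable_on UNIV"
      using f unfolding g_def integrable_restrict_UNIV .
  qed simp
  have g': "(\<lambda>t. g (- t)) integrable_on {p..q}" for p q
    using Henstock_Kurzweil_Integration.integrable_reflect_real[where f = g and a = "- q" and b = "- p"] g by simp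
  obtain N where N: "negligible N" "\<And>t e. t \<notin> N \<Longrightarrow> 0 < e \<Longrightarrow>
      \<exists>d>0. \<forall>h. 0 < h \<and> h < d \<longrightarrow> norm (integral {t..t + h} g - h *\<^sub>R g t) \<le> e * h"
    using AE_right_derivative_indefinite_integral[of g, OF g] by blast
  obtain N' where N': "negligible N'" "\<And>t e. t \<notin> N' \<Longrightarrow> 0 < e \<Longrightarrow>
      \<exists>d>0. \<forall>h. 0 < h \<and> h < d \<longrightarrow> norm (integral {t..t + h} (\<lambda>t. g (- t)) - h *\<^sub>R g (- t)) \<le> e * h"
    using AE_right_derivative_indefinite_integral[of "\<lambda>t. g (- t)", OF g'] by blast
  \<comment> \<open>The exceptional set of the reflected function has to be reflected back; smooth
    images of negligible sets are negligible.\<close>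
  have "negligible (N \<union> uminus ` N')"
    using N(1) N'(1)
    by (intro negligible_Un negligible_differentiable_image_negligible) (auto intro!: derivative_intros)
  moreover have "((\<lambda>t. c + integral {a..t} f) has_vector_derivative f t) (at t within {a..b})"
    if t: "t \<in> {a..b} - (N \<union> uminus ` N')" for t
    unfolding has_vector_derivative_def has_derivative_within_alt
  proof (intro conjI allI impI bounded_linear_scaleR_left)
    fix e :: real assume "0 < e"
    have "- t \<notin> N'" using t by (metis DiffD2 UnI2 image_eqI minus_minus)
    obtain d where "0 < d" and d: "\<And>h. 0 < h \<Longrightarrow> h < d \<Longrightarrow> norm (integral {t..t + h} g - h *\<^sub>R g t) \<le> e * h"
      using N(2)[of t e] t \<open>0 < e\<close> by blast
    obtain d' where "0 < d'" and d': "\<And>h. 0 < h \<Longrightarrow> h < d' \<Longrightarrow> norm (integral {- t..- t + h} (\<lambda>t. g (- t)) - h *\<^sub>R g t) \<le> e * h"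
      using N'(2)[OF \<open>- t \<notin> N'\<close> \<open>0 < e\<close>] by auto
    have cut: "integral {a..s} f - integral {a..r} f = integral {r..s} g" if "a \<le> r" "r \<le> s" "s \<le> b" for r s
    proof -
      have "integral {a..r} f + integral {r..s} f = integral {a..s} f"
        using that integrable_on_subinterval[OF f]
        by (intro Henstock_Kurzweil_Integration.integral_combine) auto
      moreover have "integral {r..s} f = integral {r..s} g"
        using that by (intro integral_cong) (simp add: g_def)
      ultimately show ?thesis by (metis add_diff_cancel_left')
    qed
    have gt: "g t = f t" using t by (simp add: g_def)
    show "\<exists>d>0. \<forall>y\<in>{a..b}. norm (y - t) < d \<longrightarrow>
        norm (c + integral {a..y} f - (c + integral {a..t} f) - (y - t) *\<^sub>R f t) \<le> e * norm (y - t)"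
    proof (intro exI[of _ "min d d'"] conjI ballI impI)
      fix y assume y: "y \<in> {a..b}" "norm (y - t) < min d d'"
      consider "y = t" | "t < y" | "y < t" by linarith
      then show "norm (c + integral {a..y} f - (c + integral {a..t} f) - (y - t) *\<^sub>R f t) \<le> e * norm (y - t)"
      proof cases
        case 2
        then show ?thesis using d[of "y - t"] cut[of t y] t y gt by (simp add: algebra_simps)
      next
        case 3
        have "integral {- t..- t + (t - y)} (\<lambda>t. g (- t)) = integral {y..t} g"
          using Henstock_Kurzweil_Integration.integral_reflect_real[where f = g and a = y and b = t] by simp
        then have "norm (integral {y..t} g - (t - y) *\<^sub>R f t) \<le> e * (t - y)"
          using d'[of "t - y"] 3 y gt by simp
        moreover have "norm (c + integral {a..y} f - (c + integral {a..t} f) - (y - t) *\<^sub>R f t)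
            = norm (integral {y..t} g - (t - y) *\<^sub>R f t)"
          using cut[of y t] 3 t y by (subst norm_minus_commute) (simp add: algebra_simps)
        ultimately show ?thesis using 3 by simp
      qed simp
    qed (use \<open>0 < d\<close> \<open>0 < d'\<close> in auto)
  qed
  ultimately show ?thesis
    unfolding AE_lebesgue_on_iff_negligible[OF fmeasurableD[OF lmeasurable_interval(1)]] by blast
qed

section \<open>Stability of absolute continuity under Lipschitz maps\<close>

text \<open>The Lipschitz bound is required on the range only: this range is compact, and the inner
  product and the exponential are Lipschitz on bounded sets but not globally.\<close>

lemma absolutely_continuous_curve_lipschitz_compose:
  fixes x :: "real \<Rightarrow> 'a::real_normed_vector" and \<phi> :: "'a \<Rightarrow> 'b::real_normed_vector"
  assumes x: "absolutely_continuous_curve x" and \<phi>: "C-lipschitz_on (x ` {0..1}) \<phi>"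
  shows "absolutely_continuous_curve (\<lambda>t. \<phi> (x t))"
  unfolding absolutely_continuous_curve_def
proof (intro allI impI)
  fix e :: real assume "0 < e"
  have C: "0 \<le> C" using \<phi> by (rule lipschitz_on_nonneg)
  \<comment> \<open>\<open>C + 1\<close> in place of \<open>C\<close> avoids division by 0.\<close>
  have "0 < e / (C + 1)" using \<open>0 < e\<close> C by simp
  then obtain d where "0 < d" and d: "\<And>D T. D division_of T \<and> T \<subseteq> {0..1} \<and> (\<Sum>K\<in>D. Sup K - Inf K) < d
        \<Longrightarrow> (\<Sum>K\<in>D. norm (x (Sup K) - x (Inf K))) < e / (C + 1)"
    using x unfolding absolutely_continuous_curve_def by blast
  show "\<exists>d>0. \<forall>D T. D division_of T \<and> T \<subseteq> {0..1} \<and> (\<Sum>K\<in>D. Sup K - Inf K) < d \<longrightarrow>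
      (\<Sum>K\<in>D. norm (\<phi> (x (Sup K)) - \<phi> (x (Inf K)))) < e"
  proof (intro exI[of _ d] conjI allI impI)
    fix D T assume DT: "D division_of T \<and> T \<subseteq> {0..1} \<and> (\<Sum>K\<in>D. Sup K - Inf K) < d"
    have "norm (\<phi> (x (Sup K)) - \<phi> (x (Inf K))) \<le> C * norm (x (Sup K) - x (Inf K))" if "K \<in> D" for K
    proof -
      have "Sup K \<in> {0..1}" "Inf K \<in> {0..1}"
        using division_of_subset_cbox_real[of D T 0 1 K] DT that by auto
      then show ?thesis using lipschitz_onD[OF \<phi>] by (simp add: dist_norm)
    qed
    then have "(\<Sum>K\<in>D. norm (\<phi> (x (Sup K)) - \<phi> (x (Inf K)))) \<le> C * (\<Sum>K\<in>D. norm (x (Sup K) - x (Inf K)))"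
      by (simp add: sum_distrib_left sum_mono)
    also have "\<dots> \<le> C * (e / (C + 1))" using d[OF DT] C by (intro mult_left_mono) auto
    also have "\<dots> < e" using C \<open>0 < e\<close> by (simp add: field_simps)
    finally show "(\<Sum>K\<in>D. norm (\<phi> (x (Sup K)) - \<phi> (x (Inf K)))) < e" .
  qed fact
qed

text \<open>With pairs, differences and inner products of curves become Lipschitz images of a single
  curve.\<close>

lemma absolutely_continuous_curve_Pair:
  assumes x: "absolutely_continuous_curve x" and y: "absolutely_continuous_curve y"
  shows "absolutely_continuous_curve (\<lambda>t. (x t, y t))"
  unfolding absolutely_continuous_curve_def
proof (intro allI impI)
  fix e :: real assume "0 < e"
  then have "0 < e / 2" by simp
  obtain d where "0 < d" and d: "\<And>D T. D division_of T \<and> T \<subseteq> {0..1} \<and> (\<Sum>K\<in>D. Sup K - Inf K) < d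
        \<Longrightarrow> (\<Sum>K\<in>D. norm (x (Sup K) - x (Inf K))) < e / 2"
    using x \<open>0 < e / 2\<close> unfolding absolutely_continuous_curve_def by blast
  obtain d' where "0 < d'" and d': "\<And>D T. D division_of T \<and> T \<subseteq> {0..1} \<and> (\<Sum>K\<in>D. Sup K - Inf K) < d'
        \<Longrightarrow> (\<Sum>K\<in>D. norm (y (Sup K) - y (Inf K))) < e / 2"
    using y \<open>0 < e / 2\<close> unfolding absolutely_continuous_curve_def by blast
  show "\<exists>d>0. \<forall>D T. D division_of T \<and> T \<subseteq> {0..1} \<and> (\<Sum>K\<in>D. Sup K - Inf K) < d \<longrightarrow>
      (\<Sum>K\<in>D. norm ((x (Sup K), y (Sup K)) - (x (Inf K), y (Inf K)))) < e"
  proof (intro exI[of _ "min d d'"] conjI allI impI)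
    fix D T assume DT: "D division_of T \<and> T \<subseteq> {0..1} \<and> (\<Sum>K\<in>D. Sup K - Inf K) < min d d'"
    have "(\<Sum>K\<in>D. norm ((x (Sup K), y (Sup K)) - (x (Inf K), y (Inf K))))
        \<le> (\<Sum>K\<in>D. norm (x (Sup K) - x (Inf K)) + norm (y (Sup K) - y (Inf K)))"
      by (rule sum_mono) (simp add: norm_Pair_le)
    also have "\<dots> < e / 2 + e / 2"
      unfolding sum.distrib using DT by (intro add_strict_mono d[of D T] d'[of D T]) auto
    finally show "(\<Sum>K\<in>D. norm ((x (Sup K), y (Sup K)) - (x (Inf K), y (Inf K)))) < e" by simp
  qed (use \<open>0 < d\<close> \<open>0 < d'\<close> in auto)
qed

lemma absolutely_continuous_curve_inner:
  fixes x y :: "real \<Rightarrow> 'a::real_inner"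
  assumes x: "absolutely_continuous_curve x" and y: "absolutely_continuous_curve y"
  shows "absolutely_continuous_curve (\<lambda>t. x t \<bullet> y t)"
proof -
  have "bounded (x ` {0..1})" "bounded (y ` {0..1})"
    using assms[THEN absolutely_continuous_curve_imp_continuous_on]
    by (auto intro!: compact_imp_bounded compact_continuous_image)
  then obtain B B' where B: "0 < B" "\<And>t. t \<in> {0..1} \<Longrightarrow> norm (x t) \<le> B"
      and B': "0 < B'" "\<And>t. t \<in> {0..1} \<Longrightarrow> norm (y t) \<le> B'"
    unfolding bounded_pos by blast
  have "(B + B')-lipschitz_on ((\<lambda>t. (x t, y t)) ` {0..1}) (\<lambda>(v, w). v \<bullet> w)"
  proof (rule lipschitz_onI)
    fix z z' assume "z \<in> (\<lambda>t. (x t, y t)) ` {0..1}" "z' \<in> (\<lambda>t. (x t, y t)) ` {0..1}"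
    then obtain t t' where t: "t \<in> {0..1}" "t' \<in> {0..1}" and [simp]: "z = (x t, y t)" "z' = (x t', y t')"
      by blast
    have "norm (x t \<bullet> y t - x t' \<bullet> y t') = norm (x t \<bullet> (y t - y t') + (x t - x t') \<bullet> y t')"
      by (simp add: inner_diff)
    also have "\<dots> \<le> norm (x t) * norm (y t - y t') + norm (x t - x t') * norm (y t')"
      by (intro norm_triangle_mono) (auto intro: Cauchy_Schwarz_ineq2)
    also have "\<dots> \<le> B * norm (z - z') + norm (z - z') * B'"
      using B B' t norm_fst_le[of "x t - x t'" "y t - y t'"] norm_snd_le[of "y t - y t'" "x t - x t'"]
      by (intro add_mono mult_mono) auto
    finally show "dist (case z of (v, w) \<Rightarrow> v \<bullet> w) (case z' of (v, w) \<Rightarrow> v \<bullet> w) \<le> (B + B') * dist z z'"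
      by (simp add: dist_norm algebra_simps)
  qed (use B B' in auto)
  from absolutely_continuous_curve_lipschitz_compose[OF absolutely_continuous_curve_Pair[OF x y] this]
  show ?thesis by simp
qed

lemma absolutely_continuous_curve_diff:
  fixes x y :: "real \<Rightarrow> 'a::real_normed_vector"
  assumes x: "absolutely_continuous_curve x" and y: "absolutely_continuous_curve y"
  shows "absolutely_continuous_curve (\<lambda>t. x t - y t)"
proof -
  have "2-lipschitz_on ((\<lambda>t. (x t, y t)) ` {0..1}) (\<lambda>(v, w). v - w)"
  proof (rule lipschitz_onI)
    fix z z' :: "'a \<times> 'a"
    obtain v w v' w' where [simp]: "z = (v, w)" "z' = (v', w')" by (metis prod.collapse)
    have "norm ((v - w) - (v' - w')) = norm ((v - v') - (w - w'))" by (simp add: algebra_simps)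
    also have "\<dots> \<le> norm (v - v') + norm (w - w')" by (rule norm_triangle_ineq4)
    also have "\<dots> \<le> norm (z - z') + norm (z - z')"
      using norm_fst_le[of "v - v'" "w - w'"] norm_snd_le[of "w - w'" "v - v'"] by (intro add_mono) auto
    finally show "dist (case z of (v, w) \<Rightarrow> v - w) (case z' of (v, w) \<Rightarrow> v - w) \<le> 2 * dist z z'"
      by (simp add: dist_norm)
  qed simp
  from absolutely_continuous_curve_lipschitz_compose[OF absolutely_continuous_curve_Pair[OF x y] this]
  show ?thesis by simp
qed

section \<open>Differential equations of Caratheodory type\<close>

text \<open>A continuous factor on a compact interval is bounded and measurable, so it multiplies
  integrable functions into integrable ones; \<open>h\<close> stands for the various products of
  scalars and vectors.\<close>

lemma absolutely_integrable_bilinear_continuous: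
  fixes h :: "'a::euclidean_space \<Rightarrow> 'b::euclidean_space \<Rightarrow> 'c::euclidean_space"
  assumes h: "bilinear h" and x: "continuous_on {a..b} x" and g: "g absolutely_integrable_on {a..b::real}"
  shows "(\<lambda>t. h (x t) (g t)) absolutely_integrable_on {a..b}"
proof (rule absolutely_integrable_bounded_measurable_product[OF h _ _ _ g])
  show "x \<in> borel_measurable (lebesgue_on {a..b})"
    using x by (intro continuous_imp_measurable_on_sets_lebesgue) auto
  show "bounded (x ` {a..b})"
    using x by (intro compact_imp_bounded compact_continuous_image) auto
qed auto

lemmas absolutely_integrable_scaleR_continuous =
  absolutely_integrable_bilinear_continuous[OF bilinear_conv_bounded_bilinear[THEN iffD2, OF bounded_bilinear_scaleR]]

lemmas absolutely_integrable_mult_continuous =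
  absolutely_integrable_bilinear_continuous[OF bilinear_conv_bounded_bilinear[THEN iffD2, OF bounded_bilinear_mult]]

lemma absolutely_integrable_imp_integrable_on_subinterval:
  fixes f :: "real \<Rightarrow> 'a::euclidean_space"
  assumes "f absolutely_integrable_on {a..b}" "{c..d} \<subseteq> {a..b}"
  shows "f integrable_on {c..d}"
  using absolutely_integrable_on_subinterval[OF assms] set_lebesgue_integral_eq_integral(1) by blast

lemma has_integral_one_minus:
  fixes f :: "real \<Rightarrow> 'a::euclidean_space"
  assumes "(f has_integral i) {a..b}"
  shows "((\<lambda>s. f (1 - s)) has_integral i) {1 - b..1 - a}"
proof -
  have "((\<lambda>s. f (- 1 *\<^sub>R s + 1)) has_integral (1 / \<bar>- 1\<bar> ^ DIM(real)) *\<^sub>R i)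
      ((\<lambda>s. (1 / - 1) *\<^sub>R s + - ((1 / - 1) *\<^sub>R 1)) ` cbox a b)"
    using assms by (intro has_integral_affinity) auto
  moreover have "(\<lambda>s. (1 / - 1) *\<^sub>R s + - ((1 / - 1) *\<^sub>R 1)) ` cbox a b = {1 - b..1 - a}"
  proof -
    have "(\<lambda>s. (1 / - 1) *\<^sub>R s + - ((1 / - 1) *\<^sub>R 1)) = (-) (1 :: real)" by auto
    then show ?thesis using image_diff_atLeastAtMost[of 1 a b] by simp
  qed
  ultimately show ?thesis by simp
qed

lemma integral_one_minus:
  fixes f :: "real \<Rightarrow> 'a::euclidean_space"
  shows "integral {1 - b..1 - a} (\<lambda>s. f (1 - s)) = integral {a..b} f"
proof (cases "f integrable_on {a..b}")
  case True
  then show ?thesis by (intro integral_unique has_integral_one_minus) (rule integrable_integral)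
next
  \<comment> \<open>Both integrals then have the default value 0.\<close>
  case False
  have "\<not> (\<lambda>s. f (1 - s)) integrable_on {1 - b..1 - a}"
  proof
    assume "(\<lambda>s. f (1 - s)) integrable_on {1 - b..1 - a}"
    then obtain i where "((\<lambda>s. f (1 - s)) has_integral i) {1 - b..1 - a}" by blast
    from has_integral_one_minus[OF this] False show False by auto
  qed
  with False show ?thesis by (simp add: not_integrable_integral)
qed

lemma absolutely_integrable_one_minus:
  fixes f :: "real \<Rightarrow> 'a::euclidean_space"
  assumes "f absolutely_integrable_on {0..1}"
  shows "(\<lambda>s. f (1 - s)) absolutely_integrable_on {0..1}"
proof -
  have "f integrable_on {0..1}" "(\<lambda>s. norm (f s)) integrable_on {0..1}"
    using assms by (auto simp: absolutely_integrable_on_def)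
  then have "(\<lambda>s. f (1 - s)) integrable_on {0..1}" "(\<lambda>s. norm (f (1 - s))) integrable_on {0..1}"
    using has_integral_one_minus[of f _ 0 1] has_integral_one_minus[of "\<lambda>s. norm (f s)" _ 0 1]
    by (auto simp: integrable_on_def)
  then show ?thesis by (simp add: absolutely_integrable_on_def)
qed

section \<open>The exponential weight and Gronwall's inequality\<close>

text \<open>The weight of a Bielecki norm. The 2 in the exponent reappears as the factor 1/2 in
  \<open>exp_weight_has_integral\<close>, which is the contraction rate.\<close>

definition exp_weight :: "(real \<Rightarrow> real) \<Rightarrow> real \<Rightarrow> real" where
  "exp_weight m t = exp (2 * integral {0..t} m)"

lemma exp_weight_pos: "0 < exp_weight m t"
  by (simp add: exp_weight_def)

lemma continuous_on_exp_weight: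
  assumes "m absolutely_integrable_on {0..1}"
  shows "continuous_on {0..1} (exp_weight m)"
  unfolding exp_weight_def
  using absolutely_integrable_imp_integrable_on_subinterval[OF assms, of 0 1]
  by (intro continuous_intros indefinite_integral_continuous_1) auto

lemma exp_weight_mono:
  assumes m: "m absolutely_integrable_on {0..1}" "\<And>t. t \<in> {0..1} \<Longrightarrow> 0 \<le> m t"
    and st: "0 \<le> s" "s \<le> t" "t \<le> 1"
  shows "exp_weight m s \<le> exp_weight m t"
  unfolding exp_weight_def
  using st m absolutely_integrable_imp_integrable_on_subinterval[OF m(1)]
  by (simp, intro integral_subset_le) auto

text \<open>As \<open>m\<close> is merely integrable, the chain rule is available almost everywhere
  only. The weight is absolutely continuous, the exponential being Lipschitz on the bounded range of
  the primitive \<open>M\<close>, and so it is recovered from its derivative.\<close>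

lemma exp_weight_has_integral:
  assumes m: "m absolutely_integrable_on {0..1}" and t: "t \<in> {0..1}"
  shows "((\<lambda>s. m s * exp_weight m s) has_integral (exp_weight m t - 1) / 2) {0..t}"
proof -
  define M where "M = (\<lambda>t. 0 + integral {0..t} m)"
  have M: "absolutely_continuous_curve M"
    unfolding M_def using m by (rule absolutely_continuous_curve_indefinite_integral)
  have "bounded (M ` {0..1})"
    using absolutely_continuous_curve_imp_continuous_on[OF M] by (intro compact_imp_bounded compact_continuous_image) auto
  then obtain B where "\<forall>r\<in>M ` {0..1}. norm r \<le> B"
    unfolding bounded_iff by blast
  then have B: "\<And>t. t \<in> {0..1} \<Longrightarrow> \<bar>M t\<bar> \<le> B" by simp
  have "(2 * exp (2 * B))-lipschitz_on {- B..B} (\<lambda>r :: real. exp (2 * r))"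
  proof (rule bounded_derivative_imp_lipschitz)
    show "((\<lambda>r. exp (2 * r)) has_derivative (\<lambda>h. h * (2 * exp (2 * r)))) (at r within {- B..B})" for r :: real
      by (auto intro!: derivative_eq_intros)
    show "onorm (\<lambda>h. h * (2 * exp (2 * r))) \<le> 2 * exp (2 * B)" if "r \<in> {- B..B}" for r :: real
      using that by (intro onorm_le) (auto simp: abs_mult mult.commute intro!: mult_left_mono)
  qed auto
  then have "(2 * exp (2 * B))-lipschitz_on (M ` {0..1}) (\<lambda>r :: real. exp (2 * r))"
    by (rule lipschitz_on_subset) (use B in \<open>fastforce simp: abs_le_iff\<close>)
  from absolutely_continuous_curve_lipschitz_compose[OF M this]
  have ac: "absolutely_continuous_curve (exp_weight m)"
    by (simp add: exp_weight_def[abs_def] M_def)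
  have "AE s in lebesgue_on {0..1}. (M has_vector_derivative m s) (at s within {0..1})"
    unfolding M_def using m by (intro indefinite_integral_has_vector_derivative_AE) (rule absolutely_integrable_imp_integrable_on_subinterval, auto)
  then have "AE s in lebesgue_on {0..1}. (exp_weight m has_vector_derivative 2 * (m s * exp_weight m s)) (at s within {0..1})"
  proof eventually_elim
    case (elim s)
    then have "(M has_real_derivative m s) (at s within {0..1})"
      by (simp add: has_real_derivative_iff_has_vector_derivative)
    then have "((\<lambda>s. exp (2 * M s)) has_real_derivative exp (2 * M s) * (2 * m s)) (at s within {0..1})"
      by (auto intro!: derivative_eq_intros)
    then show ?case
      by (simp add: has_real_derivative_iff_has_vector_derivative M_def exp_weight_def[abs_def] mult_ac)
  qed
  from absolutely_continuous_curve_has_integral[OF ac this, of 0 t] t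
  have "((\<lambda>s. 2 * (m s * exp_weight m s)) has_integral (exp_weight m t - 1)) {0..t}"
    by (simp add: exp_weight_def)
  from has_integral_mult_right[OF this, of "1 / 2"] show ?thesis by simp
qed

text \<open>The ratio of the function to the weight attains its supremum, and at that point the weight
  absorbs half of the integral term; the factor 2 is the price for this shortcut.\<close>

lemma gronwall_absolutely_integrable:
  assumes m: "m absolutely_integrable_on {0..1}" "\<And>t. t \<in> {0..1} \<Longrightarrow> 0 \<le> m t"
    and g: "continuous_on {0..1} g" and "0 \<le> c"
    and le: "\<And>t. t \<in> {0..1} \<Longrightarrow> g t \<le> c + integral {0..t} (\<lambda>s. m s * g s)"
    and t: "t \<in> {0..1}"
  shows "g t \<le> 2 * c * exp_weight m 1"
proof -
  let ?E = "exp_weight m"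
  have "continuous_on {0..1} (\<lambda>t. g t / ?E t)"
    using g continuous_on_exp_weight[OF m(1)] exp_weight_pos[of m]
    by (intro continuous_on_divide) (auto simp: less_imp_neq[THEN not_sym])
  then obtain r where r: "r \<in> {0..1}" and max: "\<And>t. t \<in> {0..1} \<Longrightarrow> g t / ?E t \<le> g r / ?E r"
    using continuous_attains_sup[of "{0..1::real}" "\<lambda>t. g t / ?E t"] by auto
  define S where "S = g r / ?E r"
  have gS: "g t \<le> S * ?E t" if "t \<in> {0..1}" for t
    using max[OF that] exp_weight_pos[of m t] by (simp add: S_def pos_divide_le_eq)
  have "(\<lambda>s. g s * m s) absolutely_integrable_on {0..1}"
    using g m(1) by (rule absolutely_integrable_mult_continuous)
  then have mg: "(\<lambda>s. m s * g s) integrable_on {0..r}"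
    using r absolutely_integrable_imp_integrable_on_subinterval[where f = "\<lambda>s. g s * m s" and a = 0 and b = 1] by (simp add: mult.commute)
  have "S * ?E r = g r" using exp_weight_pos[of m r] by (simp add: S_def)
  also have "g r \<le> c + integral {0..r} (\<lambda>s. m s * g s)" by (rule le[OF r])
  also have "integral {0..r} (\<lambda>s. m s * g s) \<le> S * ((?E r - 1) / 2)"
  proof (rule has_integral_le[OF integrable_integral[OF mg] has_integral_mult_right[OF exp_weight_has_integral[OF m(1) r]]])
    fix s assume "s \<in> {0..r}"
    then have "s \<in> {0..1}" using r by auto
    then show "m s * g s \<le> S * (m s * ?E s)"
      using mult_left_mono[OF gS m(2)] by (simp add: mult_ac)
  qed
  \<comment> \<open>From S E \<le> c + S (E - 1) / 2, with E the weight at the point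
    \<open>r\<close> of maximum.\<close>
  finally have *: "S * (?E r + 1) \<le> 2 * c" by (simp add: field_simps)
  have "S \<le> 2 * c"
  \<comment> \<open>\<open>g\<close> may take negative values only; then \<open>S\<close> is
    negative and the bound is trivial.\<close>
  proof (cases "0 \<le> S")
    case True
    then have "S * 1 \<le> S * (?E r + 1)" using exp_weight_pos[of m r] by (intro mult_left_mono) auto
    with * show ?thesis by simp
  qed (use \<open>0 \<le> c\<close> in simp)
  have "g t \<le> S * ?E t" by (rule gS[OF t])
  also have "\<dots> \<le> 2 * c * ?E t" using \<open>S \<le> 2 * c\<close> exp_weight_pos[of m t] by (intro mult_right_mono) auto
  also have "\<dots> \<le> 2 * c * ?E 1" using \<open>0 \<le> c\<close> t by (intro mult_left_mono exp_weight_mono m) auto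
  finally show ?thesis .
qed

section \<open>Initial value problems with an integrable Lipschitz rate\<close>

text \<open>A rate that is integrable in time, in place of a constant, admits unbounded controls.
  Regularity in time is asked in the form in which the Picard operator uses it: superposition with a
  continuous curve is integrable.\<close>

locale caratheodory_lipschitz =
  fixes f :: "real \<Rightarrow> 'a::euclidean_space \<Rightarrow> 'a" and m :: "real \<Rightarrow> real"
  assumes m: "m absolutely_integrable_on {0..1}" "\<And>t. t \<in> {0..1} \<Longrightarrow> 0 \<le> m t"
    and lipschitz: "\<And>t y z. t \<in> {0..1} \<Longrightarrow> norm (f t y - f t z) \<le> m t * norm (y - z)"
    and integrable: "\<And>y. continuous_on {0..1} y \<Longrightarrow> (\<lambda>t. f t (y t)) absolutely_integrable_on {0..1}"
begin

lemma integrable_on_subinterval: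
  assumes "continuous_on {0..1} y" "0 \<le> a" "b \<le> 1"
  shows "(\<lambda>t. f t (y t)) integrable_on {a..b}"
  using assms integrable by (intro absolutely_integrable_imp_integrable_on_subinterval) auto

text \<open>The common estimate behind uniqueness, contraction and dependence on data.\<close>

lemma norm_integral_diff_le:
  assumes y: "continuous_on {0..1} y" and z: "continuous_on {0..1} z" and t: "t \<in> {0..1}"
  shows "norm (integral {0..t} (\<lambda>s. f s (y s)) - integral {0..t} (\<lambda>s. f s (z s)))
    \<le> integral {0..t} (\<lambda>s. m s * norm (y s - z s))"
proof -
  have "(\<lambda>s. norm (y s - z s) * m s) absolutely_integrable_on {0..1}"
    using y z m by (intro absolutely_integrable_mult_continuous continuous_intros)
  then have "(\<lambda>s. m s * norm (y s - z s)) integrable_on {0..t}"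
    using t absolutely_integrable_imp_integrable_on_subinterval[where f = "\<lambda>s. norm (y s - z s) * m s" and a = 0 and b = 1]
    by (simp add: mult.commute)
  moreover have "integral {0..t} (\<lambda>s. f s (y s)) - integral {0..t} (\<lambda>s. f s (z s)) =
      integral {0..t} (\<lambda>s. f s (y s) - f s (z s))"
    using t y z by (intro integral_diff[symmetric] integrable_on_subinterval) auto
  ultimately show ?thesis
    using t y z lipschitz
    by (auto intro!: integral_norm_bound_integral integrable_diff integrable_on_subinterval)
qed

lemma integral_equation_unique:
  assumes y: "continuous_on {0..1} y" "\<And>t. t \<in> {0..1} \<Longrightarrow> y t = c + integral {0..t} (\<lambda>s. f s (y s))"
    and z: "continuous_on {0..1} z" "\<And>t. t \<in> {0..1} \<Longrightarrow> z t = c + integral {0..t} (\<lambda>s. f s (z s))"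
    and t: "t \<in> {0..1}"
  shows "y t = z t"
proof -
  have "norm (y t - z t) \<le> 2 * 0 * exp_weight m 1"
  proof (rule gronwall_absolutely_integrable[OF m, where g = "\<lambda>t. norm (y t - z t)"])
    fix t :: real assume t: "t \<in> {0..1}"
    show "norm (y t - z t) \<le> 0 + integral {0..t} (\<lambda>s. m s * norm (y s - z s))"
      using norm_integral_diff_le[OF y(1) z(1) t] y(2)[OF t] z(2)[OF t] by simp
  qed (use y z t in \<open>auto intro!: continuous_intros\<close>)
  then show ?thesis by simp
qed

text \<open>Banach's fixed point theorem is applied to the quotient \<phi> of the curve by the
  weight: the plain supremum norm of \<phi> is the weighted norm of the curve, so the complete space
  of bounded continuous functions serves unchanged.\<close>

lemma integral_equation_exists:
  "\<exists>y. continuous_on {0..1} y \<and> (\<forall>t\<in>{0..1}. y t = c + integral {0..t} (\<lambda>s. f s (y s)))"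
proof -
  let ?E = "exp_weight m"
  have Epos: "0 < ?E t" for t by (rule exp_weight_pos)
  have contE: "continuous_on {0..1} ?E" by (rule continuous_on_exp_weight[OF m(1)])
  \<comment> \<open>Bounded continuous functions live on the whole line; clamping the time extends a
    curve on \<open>{0..1}\<close> by its end values.\<close>
  define cl where "cl = (\<lambda>t :: real. max 0 (min 1 t))"
  have cl: "cl t \<in> {0..1}" "t \<in> {0..1} \<Longrightarrow> cl t = t" for t by (auto simp: cl_def)
  have contcl: "continuous_on UNIV cl" unfolding cl_def by (intro continuous_intros)
  have cont\<phi>: "continuous_on {0..1} (\<lambda>s. ?E s *\<^sub>R apply_bcontfun \<phi> s)" for \<phi> :: "real \<Rightarrow>\<^sub>C 'a"
    using contE by (intro continuous_intros) auto
  define G where "G = (\<lambda>(\<phi> :: real \<Rightarrow>\<^sub>C 'a) t. (c + integral {0..t} (\<lambda>s. f s (?E s *\<^sub>R \<phi> s))) /\<^sub>R ?E t)"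
  have contG: "continuous_on {0..1} (G \<phi>)" for \<phi>
    unfolding G_def using contE Epos integrable_on_subinterval[OF cont\<phi>, of 0 1 \<phi>]
    by (intro continuous_intros indefinite_integral_continuous_1) (auto simp: less_imp_neq[THEN not_sym])
  define T where "T = (\<lambda>\<phi>. Bcontfun (\<lambda>t. G \<phi> (cl t)))"
  have "(\<lambda>t. G \<phi> (cl t)) \<in> bcontfun" for \<phi>
  proof -
    have "continuous_on UNIV (\<lambda>t. G \<phi> (cl t))"
      using contcl cl by (intro continuous_on_compose2[OF contG]) auto
    moreover have "bounded (G \<phi> ` {0..1})"
      using contG by (intro compact_imp_bounded compact_continuous_image) auto
    then have "bounded (range (\<lambda>t. G \<phi> (cl t)))"
      by (rule bounded_subset) (use cl in auto)
    ultimately show ?thesis by (simp add: bcontfun_def)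
  qed
  then have T: "apply_bcontfun (T \<phi>) t = G \<phi> (cl t)" for \<phi> t
    by (simp add: T_def Bcontfun_inverse)
  have "dist (T \<phi>) (T \<psi>) \<le> 1 / 2 * dist \<phi> \<psi>" for \<phi> \<psi>
  proof (rule dist_bound)
    fix r
    define t where "t = cl r"
    have t: "t \<in> {0..1}" using cl by (simp add: t_def)
    have "norm (integral {0..t} (\<lambda>s. f s (?E s *\<^sub>R \<phi> s)) - integral {0..t} (\<lambda>s. f s (?E s *\<^sub>R \<psi> s)))
        \<le> integral {0..t} (\<lambda>s. m s * norm (?E s *\<^sub>R \<phi> s - ?E s *\<^sub>R \<psi> s))"
      by (rule norm_integral_diff_le[OF cont\<phi> cont\<phi> t])
    also have "\<dots> \<le> dist \<phi> \<psi> * ((?E t - 1) / 2)"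
    proof (rule has_integral_le[OF _ has_integral_mult_right[OF exp_weight_has_integral[OF m(1) t]]])
      have "(\<lambda>s. norm (?E s *\<^sub>R \<phi> s - ?E s *\<^sub>R \<psi> s) * m s) absolutely_integrable_on {0..1}"
        using cont\<phi> m by (intro absolutely_integrable_mult_continuous continuous_on_norm continuous_on_diff)
      from absolutely_integrable_imp_integrable_on_subinterval[OF this, of 0 t] t
      show "((\<lambda>s. m s * norm (?E s *\<^sub>R \<phi> s - ?E s *\<^sub>R \<psi> s)) has_integral
          integral {0..t} (\<lambda>s. m s * norm (?E s *\<^sub>R \<phi> s - ?E s *\<^sub>R \<psi> s))) {0..t}"
        by (intro integrable_integral) (simp add: mult.commute)
      fix s assume "s \<in> {0..t}"
      then have "0 \<le> m s" using t m(2) by auto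
      have "norm (?E s *\<^sub>R \<phi> s - ?E s *\<^sub>R \<psi> s) = ?E s * dist (\<phi> s) (\<psi> s)"
        using Epos[of s] by (simp add: dist_norm flip: scaleR_diff_right)
      also have "\<dots> \<le> ?E s * dist \<phi> \<psi>"
        using Epos[of s] dist_bounded by (intro mult_left_mono) auto
      finally have "norm (?E s *\<^sub>R \<phi> s - ?E s *\<^sub>R \<psi> s) \<le> ?E s * dist \<phi> \<psi>" .
      from mult_left_mono[OF this \<open>0 \<le> m s\<close>]
      show "m s * norm (?E s *\<^sub>R \<phi> s - ?E s *\<^sub>R \<psi> s) \<le> dist \<phi> \<psi> * (m s * ?E s)"
        by (simp add: mult_ac)
    qed
    \<comment> \<open>Dropping the -1 leaves half the weight, which the division in \<open>G\<close>
      cancels.\<close>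
    also have "\<dots> \<le> 1 / 2 * dist \<phi> \<psi> * ?E t"
      by (simp add: algebra_simps)
    finally have "norm (integral {0..t} (\<lambda>s. f s (?E s *\<^sub>R \<phi> s)) - integral {0..t} (\<lambda>s. f s (?E s *\<^sub>R \<psi> s))) / ?E t
        \<le> 1 / 2 * dist \<phi> \<psi>"
      using Epos[of t] by (simp add: pos_divide_le_eq)
    moreover have "dist (T \<phi> r) (T \<psi> r) =
        norm (integral {0..t} (\<lambda>s. f s (?E s *\<^sub>R \<phi> s)) - integral {0..t} (\<lambda>s. f s (?E s *\<^sub>R \<psi> s))) / ?E t"
      using Epos[of t]
      by (simp add: T G_def dist_norm t_def[symmetric] divide_inverse mult.commute flip: scaleR_diff_right)
    ultimately show "dist (T \<phi> r) (T \<psi> r) \<le> 1 / 2 * dist \<phi> \<psi>" by simp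
  qed
  then obtain \<phi> where T\<phi>: "T \<phi> = \<phi>"
    using banach_fix_type[of "1 / 2" T] by auto
  have "?E t *\<^sub>R \<phi> t = c + integral {0..t} (\<lambda>s. f s (?E s *\<^sub>R \<phi> s))" if "t \<in> {0..1}" for t
  proof -
    have "\<phi> t = G \<phi> t" using T[of \<phi> t] cl(2)[OF that] T\<phi> by simp
    then show ?thesis using Epos[of t] by (simp add: G_def)
  qed
  with cont\<phi> show ?thesis by blast
qed

text \<open>The passage from left to right integrates an almost everywhere derivative, the converse
  differentiates an indefinite integral. Existence, uniqueness and stability are proved for the
  right-hand side, where null sets cannot be seen.\<close>

lemma integral_equation_iff:
  "absolutely_continuous_curve x \<and>
    (AE t in lebesgue_on {0..1}. (x has_vector_derivative f t (x t)) (at t within {0..1})) \<and> x 0 = c \<longleftrightarrow>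
   continuous_on {0..1} x \<and> (\<forall>t\<in>{0..1}. x t = c + integral {0..t} (\<lambda>s. f s (x s)))"
  (is "?A \<longleftrightarrow> ?B")
proof
  assume ?A
  then have x: "absolutely_continuous_curve x"
    "AE t in lebesgue_on {0..1}. (x has_vector_derivative f t (x t)) (at t within {0..1})" "x 0 = c"
    by auto
  have "x t = c + integral {0..t} (\<lambda>s. f s (x s))" if "t \<in> {0..1}" for t
    using integral_unique[OF absolutely_continuous_curve_has_integral[OF x(1,2), of 0 t]] that x(3) by simp
  then show ?B using absolutely_continuous_curve_imp_continuous_on[OF x(1)] by blast
next
  assume B: ?B
  then have eq: "\<And>t. t \<in> {0..1} \<Longrightarrow> c + integral {0..t} (\<lambda>s. f s (x s)) = x t" by simp
  have "absolutely_continuous_curve x"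
    using absolutely_continuous_curve_cong[OF absolutely_continuous_curve_indefinite_integral[OF integrable] eq] B by blast
  moreover have "AE t in lebesgue_on {0..1}. ((\<lambda>t. c + integral {0..t} (\<lambda>s. f s (x s))) has_vector_derivative f t (x t)) (at t within {0..1})"
    using B by (intro indefinite_integral_has_vector_derivative_AE integrable_on_subinterval) auto
  then have "AE t in lebesgue_on {0..1}. (x has_vector_derivative f t (x t)) (at t within {0..1})"
    using AE_space
  proof eventually_elim
    case (elim t)
    then show ?case by (intro has_vector_derivative_transform[OF _ eq[symmetric] elim(1)]) auto
  qed
  moreover have "x 0 = c" using eq[of 0] by simp
  ultimately show ?A by blast
qed

theorem initial_value_problem:
  "\<exists>!x. x \<in> extensional {0..1} \<and> absolutely_continuous_curve x \<and>
    (AE t in lebesgue_on {0..1}. (x has_vector_derivative f t (x t)) (at t within {0..1})) \<and> x 0 = c"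
proof -
  obtain y where y: "continuous_on {0..1} y" "\<And>t. t \<in> {0..1} \<Longrightarrow> y t = c + integral {0..t} (\<lambda>s. f s (y s))"
    using integral_equation_exists by blast
  show ?thesis
    unfolding integral_equation_iff
  \<comment> \<open>The solution is reset outside \<open>{0..1}\<close>, as uniqueness means
    equality of functions.\<close>
  proof (rule ex1I[of _ "restrict y {0..1}"])
    have "integral {0..t} (\<lambda>s. f s (restrict y {0..1} s)) = integral {0..t} (\<lambda>s. f s (y s))" if "t \<in> {0..1}" for t
      using that by (intro integral_cong) auto
    then have "restrict y {0..1} t = c + integral {0..t} (\<lambda>s. f s (restrict y {0..1} s))" if "t \<in> {0..1}" for t
      using that y(2)[OF that] by simp
    moreover have "continuous_on {0..1} (restrict y {0..1})"
      using y(1) by (rule continuous_on_eq) simp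
    ultimately show "restrict y {0..1} \<in> extensional {0..1} \<and> continuous_on {0..1} (restrict y {0..1}) \<and>
        (\<forall>t\<in>{0..1}. restrict y {0..1} t = c + integral {0..t} (\<lambda>s. f s (restrict y {0..1} s)))"
      by (intro conjI ballI restrict_extensional)
    fix x
    assume x: "x \<in> extensional {0..1} \<and> continuous_on {0..1} x \<and>
        (\<forall>t\<in>{0..1}. x t = c + integral {0..t} (\<lambda>s. f s (x s)))"
    have "x t = y t" if "t \<in> {0..1}" for t
      by (rule integral_equation_unique[OF _ _ y that]) (use x in blast)+
    with x show "x = restrict y {0..1}" by (auto intro: extensionalityI[of _ "{0..1}"])
  qed
qed

text \<open>\<open>z\<close> solves an equation of its own, and \<open>r\<close> bounds its defect
  in the equation of \<open>y\<close>. This serves both a change of control and a change of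
  parameter.\<close>

lemma perturbation_bound:
  assumes y: "continuous_on {0..1} y" "\<And>t. t \<in> {0..1} \<Longrightarrow> y t = c + integral {0..t} (\<lambda>s. f s (y s))"
    and z: "continuous_on {0..1} z" "\<And>t. t \<in> {0..1} \<Longrightarrow> z t = d + integral {0..t} g"
    and g: "g integrable_on {0..1}" and r: "r integrable_on {0..1}"
    and gr: "\<And>s. s \<in> {0..1} \<Longrightarrow> norm (f s (z s) - g s) \<le> r s"
    and t: "t \<in> {0..1}"
  shows "norm (y t - z t) \<le> 2 * (norm (c - d) + integral {0..1} r) * exp_weight m 1"
proof (rule gronwall_absolutely_integrable[OF m, where g = "\<lambda>t. norm (y t - z t)"])
  have r0: "0 \<le> r s" if "s \<in> {0..1}" for s
    using gr[OF that] norm_ge_zero order_trans by blast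
  then show "0 \<le> norm (c - d) + integral {0..1} r"
    using integral_nonneg[OF r] by simp
  fix t :: real assume t: "t \<in> {0..1}"
  then have sub: "{0..t} \<subseteq> {0..1}" by auto
  have fz: "(\<lambda>s. f s (z s)) integrable_on {0..t}" using z(1) t by (intro integrable_on_subinterval) auto
  have gt: "g integrable_on {0..t}" and rt: "r integrable_on {0..t}"
    using g r sub integrable_on_subinterval by (auto intro: Henstock_Kurzweil_Integration.integrable_on_subinterval)
  have "norm (integral {0..t} (\<lambda>s. f s (z s)) - integral {0..t} g) = norm (integral {0..t} (\<lambda>s. f s (z s) - g s))"
    by (simp add: integral_diff[OF fz gt])
  also have "\<dots> \<le> integral {0..t} r"
    using gr sub by (intro integral_norm_bound_integral integrable_diff fz gt rt) auto
  also have "\<dots> \<le> integral {0..1} r"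
    using r0 by (intro integral_subset_le[OF sub rt r]) auto
  finally have *: "norm (integral {0..t} (\<lambda>s. f s (z s)) - integral {0..t} g) \<le> integral {0..1} r" .
  \<comment> \<open>The velocity \<open>f\<close> along \<open>z\<close> is inserted: one difference
    is the defect, the other is governed by the Lipschitz rate.\<close>
  have eq: "y t - z t = (c - d) + (integral {0..t} (\<lambda>s. f s (z s)) - integral {0..t} g)
      + (integral {0..t} (\<lambda>s. f s (y s)) - integral {0..t} (\<lambda>s. f s (z s)))"
    by (subst y(2)[OF t], subst z(2)[OF t]) simp
  have "norm (y t - z t) \<le> norm (c - d) + norm (integral {0..t} (\<lambda>s. f s (z s)) - integral {0..t} g)
      + norm (integral {0..t} (\<lambda>s. f s (y s)) - integral {0..t} (\<lambda>s. f s (z s)))"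
    unfolding eq by (intro norm_triangle_mono order_refl)
  also have "\<dots> \<le> norm (c - d) + integral {0..1} r + integral {0..t} (\<lambda>s. m s * norm (y s - z s))"
    using * norm_integral_diff_le[OF y(1) z(1) t] by (intro add_mono) auto
  finally show "norm (y t - z t) \<le> norm (c - d) + integral {0..1} r + integral {0..t} (\<lambda>s. m s * norm (y s - z s))" .
qed (use y(1) z(1) t in \<open>auto intro!: continuous_intros\<close>)

section \<open>Terminal value problems by reversal of time\<close>

text \<open>The curve \<open>\<lambda>t. y (1 - t)\<close> runs backwards, so a value prescribed at
  1 becomes an initial value.\<close>

lemma reversed: "caratheodory_lipschitz (\<lambda>t y. - f (1 - t) y) (\<lambda>t. m (1 - t))"
proof
  show "(\<lambda>t. m (1 - t)) absolutely_integrable_on {0..1}"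
    using m(1) by (rule absolutely_integrable_one_minus)
  show "norm (- f (1 - t) y - - f (1 - t) z) \<le> m (1 - t) * norm (y - z)" if "t \<in> {0..1}" for t y z
    using lipschitz[of "1 - t" z y] that by (simp add: norm_minus_commute)
  show "(\<lambda>t. - f (1 - t) (y t)) absolutely_integrable_on {0..1}" if "continuous_on {0..1} y" for y
  proof -
    have "continuous_on {0..1} (\<lambda>t. y (1 - t))"
      by (rule continuous_on_compose2[OF that]) (auto intro!: continuous_intros)
    from absolutely_integrable_one_minus[OF integrable[OF this]]
    have "(\<lambda>t. (- 1) *\<^sub>R f (1 - t) (y t)) absolutely_integrable_on {0..1}"
      by (intro absolutely_integrable_scaleR_left) simp
    then show ?thesis by simp
  qed
qed (use m(2) in auto)

lemma integral_reversed:
  assumes "continuous_on {0..1} y" "t \<in> {0..1}"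
  shows "integral {0..t} (\<lambda>s. - f (1 - s) (y (1 - s))) =
    integral {0..1 - t} (\<lambda>s. f s (y s)) - integral {0..1} (\<lambda>s. f s (y s))"
proof -
  have *: "integral {0..1 - t} (\<lambda>s. f s (y s)) + integral {1 - t..1} (\<lambda>s. f s (y s)) = integral {0..1} (\<lambda>s. f s (y s))"
    using assms by (intro Henstock_Kurzweil_Integration.integral_combine integrable_on_subinterval) auto
  have "integral {0..t} (\<lambda>s. f (1 - s) (y (1 - s))) = integral {1 - t..1} (\<lambda>s. f s (y s))"
    using integral_one_minus[of 1 "1 - t" "\<lambda>s. f s (y s)"] by simp
  then show ?thesis by (simp add: *[symmetric])
qed

text \<open>Existence reverses a solution of the reversed initial value problem; uniqueness reverses
  both candidates.\<close>

theorem terminal_value_problem: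
  "\<exists>!x. x \<in> extensional {0..1} \<and> absolutely_continuous_curve x \<and>
    (AE t in lebesgue_on {0..1}. (x has_vector_derivative f t (x t)) (at t within {0..1})) \<and> x 1 = c"
proof -
  interpret rev: caratheodory_lipschitz "\<lambda>t y. - f (1 - t) y" "\<lambda>t. m (1 - t)" by (rule reversed)
  have rev_solution: "(\<lambda>t. x (1 - t)) t = x 1 + integral {0..t} (\<lambda>s. - f (1 - s) ((\<lambda>t. x (1 - t)) s))"
    if x: "continuous_on {0..1} x" "\<And>t. t \<in> {0..1} \<Longrightarrow> x t = d + integral {0..t} (\<lambda>s. f s (x s))" and t: "t \<in> {0..1}" for x d t
    using integral_reversed[OF x(1) t] x(2)[of "1 - t"] x(2)[of 1] t by simp
  have rev_cont: "continuous_on {0..1} (\<lambda>t. x (1 - t))" if "continuous_on {0..1} x" for x :: "real \<Rightarrow> 'a"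
    by (rule continuous_on_compose2[OF that]) (auto intro!: continuous_intros)
  obtain z where z: "continuous_on {0..1} z" "\<And>t. t \<in> {0..1} \<Longrightarrow> z t = c + integral {0..t} (\<lambda>s. - f (1 - s) (z s))"
    using rev.integral_equation_exists by blast
  define y where "y = (\<lambda>t. z (1 - t))"
  have y: "continuous_on {0..1} y" unfolding y_def by (rule rev_cont[OF z(1)])
  \<comment> \<open>The value of \<open>y\<close> at 0, read off from the integral equation that
    ends in \<open>c\<close> at time 1.\<close>
  define d where "d = c - integral {0..1} (\<lambda>s. f s (y s))"
  have y_eq: "y t = d + integral {0..t} (\<lambda>s. f s (y s))" if "t \<in> {0..1}" for t
  proof -
    have "y t = c + integral {0..1 - t} (\<lambda>s. - f (1 - s) (y (1 - s)))"
      using z(2)[of "1 - t"] that by (simp add: y_def)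
    then show ?thesis using integral_reversed[OF y, of "1 - t"] that by (simp add: d_def)
  qed
  obtain x where x: "x \<in> extensional {0..1}" and x': "absolutely_continuous_curve x \<and>
    (AE t in lebesgue_on {0..1}. (x has_vector_derivative f t (x t)) (at t within {0..1})) \<and> x 0 = d"
    using initial_value_problem[of d] by blast
  note x'' = x'[unfolded integral_equation_iff]
  have "x 1 = y 1" by (rule integral_equation_unique[OF _ _ y y_eq]) (use x'' in auto)
  also have "\<dots> = c" using y_eq[of 1] by (simp add: d_def)
  finally have "x 1 = c" .
  show ?thesis
  proof (rule ex1I[of _ x])
    fix w assume w: "w \<in> extensional {0..1} \<and> absolutely_continuous_curve w \<and>
      (AE t in lebesgue_on {0..1}. (w has_vector_derivative f t (w t)) (at t within {0..1})) \<and> w 1 = c"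
    \<comment> \<open>Any candidate solves an initial value problem with its own initial value; this
      gives access to the integral equation.\<close>
    then have "absolutely_continuous_curve w \<and>
      (AE t in lebesgue_on {0..1}. (w has_vector_derivative f t (w t)) (at t within {0..1})) \<and> w 0 = w 0" by simp
    note w'' = this[unfolded integral_equation_iff]
    have w: "w \<in> extensional {0..1}" "w 1 = c" using w by auto
    have "w (1 - t) = x (1 - t)" if t: "t \<in> {0..1}" for t
    proof (rule rev.integral_equation_unique[OF rev_cont _ rev_cont _ t])
      show "w (1 - t) = c + integral {0..t} (\<lambda>s. - f (1 - s) (w (1 - s)))" if t: "t \<in> {0..1}" for t
        unfolding w(2)[symmetric] by (rule rev_solution[OF _ _ t]) (use w'' in blast)+
      show "x (1 - t) = c + integral {0..t} (\<lambda>s. - f (1 - s) (x (1 - s)))" if t: "t \<in> {0..1}" for t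
        unfolding \<open>x 1 = c\<close>[symmetric] by (rule rev_solution[OF _ _ t]) (use x'' in blast)+
    qed (use w'' x'' in auto)
    from this[of "1 - t" for t] have "w t = x t" if "t \<in> {0..1}" for t using that by simp
    with w x show "w = x" by (auto intro: extensionalityI[of _ "{0..1}"])
  qed (use x x' \<open>x 1 = c\<close> in blast)
qed

end

section \<open>Square-integrable controls and differentiable maps\<close>

lemma square_integrable_rep_L2: "square_integrable (rep_L2 u)"
  using Quotient_rep_reflp[OF Quotient_L2, of u] by (simp add: L2_rel_def)

text \<open>\<open>rep_L2\<close> picks one representative of a class, so \<open>f\<close> comes
  back up to a null set only.\<close>

lemma rep_L2_abs_L2:
  assumes "square_integrable f"
  shows "AE t in lebesgue_on {0..1}. rep_L2 (abs_L2 f) t = f t"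
  using Quotient_rep_abs[OF Quotient_L2, of f] assms by (simp add: L2_rel_def)

lemma abs_L2_rep_L2: "abs_L2 (rep_L2 u) = u"
  by (rule Quotient_abs_rep[OF Quotient_L2])

lemma rep_L2_add: "AE t in lebesgue_on {0..1}. rep_L2 (u + v) t = rep_L2 u t + rep_L2 v t"
proof -
  have "u + v = abs_L2 (\<lambda>t. rep_L2 u t + rep_L2 v t)"
    using plus_L2.abs_eq[of "rep_L2 u" "rep_L2 v"]
    by (simp add: abs_L2_rep_L2 L2_rel_def square_integrable_rep_L2)
  then show ?thesis
    using rep_L2_abs_L2[of "\<lambda>t. rep_L2 u t + rep_L2 v t"] by (simp add: square_integrable_add square_integrable_rep_L2)
qed

lemma rep_L2_scaleR: "AE t in lebesgue_on {0..1}. rep_L2 (c *\<^sub>R u) t = c *\<^sub>R rep_L2 u t"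
proof -
  have "c *\<^sub>R u = abs_L2 (\<lambda>t. c *\<^sub>R rep_L2 u t)"
    using scaleR_L2.abs_eq[of "rep_L2 u" c]
    by (simp add: abs_L2_rep_L2 L2_rel_def square_integrable_rep_L2)
  then show ?thesis
    using rep_L2_abs_L2[of "\<lambda>t. c *\<^sub>R rep_L2 u t"] by (simp add: square_integrable_scaleR square_integrable_rep_L2)
qed

lemma rep_L2_add_scaleR:
  "AE t in lebesgue_on {0..1}. rep_L2 (u + h *\<^sub>R v) t = rep_L2 u t + h *\<^sub>R rep_L2 v t"
  using rep_L2_add[of u "h *\<^sub>R v"] rep_L2_scaleR[of h v] by eventually_elim simp

text \<open>The inner product is a Bochner integral, whereas the convergence theorem applied to the
  cost is that of the gauge integral.\<close>

lemma inner_L2_eq_integral: "u \<bullet> v = integral {0..1} (\<lambda>t. rep_L2 u t \<bullet> rep_L2 v t)"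
proof -
  have "u \<bullet> v = (LINT t|lebesgue_on {0..1}. rep_L2 u t \<bullet> rep_L2 v t)"
    by (simp add: inner_L2_def)
  moreover have "((\<lambda>t. rep_L2 u t \<bullet> rep_L2 v t) has_integral (LINT t|lebesgue_on {0..1}. rep_L2 u t \<bullet> rep_L2 v t)) {0..1}"
    by (intro has_integral_integral_lebesgue_on square_integrable_inner square_integrable_rep_L2) auto
  ultimately show ?thesis by (simp add: integral_unique)
qed

lemma inner_abs_L2:
  assumes "square_integrable f"
  shows "abs_L2 f \<bullet> v = integral {0..1} (\<lambda>t. f t \<bullet> rep_L2 v t)"
proof -
  obtain N where "negligible N" "\<forall>t\<in>{0..1} - N. rep_L2 (abs_L2 f) t = f t"
    using rep_L2_abs_L2[OF assms] by (auto simp: AE_lebesgue_on_iff_negligible)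
  then show ?thesis
    unfolding inner_L2_eq_integral by (intro integral_spike[of N]) auto
qed

lemma square_integrable_continuous:
  assumes "continuous_on {0..1} f"
  shows "square_integrable f"
proof -
  have "(\<lambda>t. (norm (f t))\<^sup>2) absolutely_integrable_on {0..1}"
    using assms by (intro absolutely_integrable_continuous_real continuous_intros)
  then show ?thesis
    using assms unfolding square_integrable_def
    by (auto simp: set_integrable_def integrable_restrict_space intro: continuous_imp_measurable_on_sets_lebesgue)
qed

text \<open>L2 lies in L1 on an interval of finite length, with
  \<open>1 + (norm (f t))\<^sup>2\<close> as a majorant.\<close>

lemma square_integrable_imp_absolutely_integrable:
  assumes "square_integrable f"
  shows "f absolutely_integrable_on {0..1}"
proof (rule measurable_bounded_by_integrable_imp_absolutely_integrable)
  show "f \<in> borel_measurable (lebesgue_on {0..1})"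
    using assms by (simp add: square_integrable_def)
  have "(\<lambda>t. (norm (f t))\<^sup>2) integrable_on {0..1}"
    using assms by (intro integrable_on_lebesgue_on) (auto simp: square_integrable_def)
  then show "(\<lambda>t. 1 + (norm (f t))\<^sup>2) integrable_on {0..1}"
    by (intro integrable_add) auto
  show "norm (f t) \<le> 1 + (norm (f t))\<^sup>2" for t
  proof -
    have "2 * norm (f t) \<le> 1 + (norm (f t))\<^sup>2"
      using sum_squares_bound[of 1 "norm (f t)"] by simp
    then show ?thesis using norm_ge_zero[of "f t"] by linarith
  qed
qed simp

lemma absolutely_integrable_nth:
  fixes f :: "real \<Rightarrow> real^'k"
  assumes "f absolutely_integrable_on S"
  shows "(\<lambda>t. f t $ i) absolutely_integrable_on S"
  using absolutely_integrable_linear[OF assms bounded_linear_vec_nth[of i]] by (simp add: o_def)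

lemma continuous_on_vec_componentwise:
  fixes f :: "'a::topological_space \<Rightarrow> 'b::real_normed_vector^'n"
  assumes "\<And>i. continuous_on S (\<lambda>x. f x $ i)"
  shows "continuous_on S f"
  using continuous_on_vec_lambda[of S "\<lambda>i x. f x $ i"] assms by (simp add: vec_nth_inverse)

section \<open>Jacobians, gradients and Taylor remainders of regular maps\<close>

text \<open>Regularity is assumed for the matrix field \<open>F\<close>, while Jacobians are taken
  of its columns; \<open>column i\<close> is the bounded linear map in question.\<close>

lemma C1_regular_bounded_linear_compose:
  assumes "bounded_linear g" "C1_regular f"
  shows "C1_regular (\<lambda>x. g (f x))"
proof -
  obtain f' where f': "\<And>x. (f has_derivative blinfun_apply (f' x)) (at x)" "continuous_on UNIV f'"
    using assms(2) unfolding C1_regular_def by blast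
  have "((\<lambda>x. g (f x)) has_derivative blinfun_apply (Blinfun g o\<^sub>L f' x)) (at x)" for x
  proof -
    have "blinfun_apply (Blinfun g o\<^sub>L f' x) = (\<lambda>h. g (f' x h))"
      by (simp add: fun_eq_iff bounded_linear_Blinfun_apply[OF assms(1)])
    then show ?thesis using bounded_linear.has_derivative[OF assms(1) f'(1)] by simp
  qed
  moreover have "continuous_on UNIV (\<lambda>x. Blinfun g o\<^sub>L f' x)"
    using f'(2) by (intro continuous_intros)
  ultimately show ?thesis
    unfolding C1_regular_def by (intro exI[of _ "\<lambda>x. Blinfun g o\<^sub>L f' x"] conjI allI)
qed

text \<open>Regularity speaks of some continuous family of derivatives and the adjoint equation of
  \<open>jacobian\<close>; uniqueness of the derivative identifies them.\<close>

lemma C1_regular_jacobian: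
  fixes f :: "real^'n \<Rightarrow> real^'m"
  assumes "C1_regular f"
  shows "(f has_derivative (*v) (jacobian f (at x))) (at x)"
    and "continuous_on UNIV (\<lambda>x. jacobian f (at x))"
proof -
  obtain f' where f': "\<And>x. (f has_derivative blinfun_apply (f' x)) (at x)" "continuous_on UNIV f'"
    using assms unfolding C1_regular_def by blast
  show "(f has_derivative (*v) (jacobian f (at x))) (at x)"
    using f'(1) jacobian_works differentiable_def by blast
  have "jacobian f (at x) = matrix (blinfun_apply (f' x))" for x
    using frechet_derivative_at[OF f'(1)[of x]] by (simp add: jacobian_def)
  moreover have "continuous_on UNIV (\<lambda>x. matrix (blinfun_apply (f' x)))"
    using f'(2) unfolding matrix_def
    by (intro continuous_on_vec_lambda continuous_intros)
  ultimately show "continuous_on UNIV (\<lambda>x. jacobian f (at x))" by simp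
qed

text \<open>Riesz representation in coordinates. Uniqueness turns the terminal condition, stated as
  a relation, into a prescribed value.\<close>

lemma gderiv_exists_unique:
  fixes f :: "'a::euclidean_space \<Rightarrow> real"
  assumes "f differentiable at x"
  shows "\<exists>!D. GDERIV f x :> D"
proof -
  obtain f' where f': "(f has_derivative f') (at x)" using assms by (auto simp: differentiable_def)
  interpret f': bounded_linear f' using f' by (rule has_derivative_bounded_linear)
  define D where "D = (\<Sum>b\<in>Basis. f' b *\<^sub>R b)"
  have "f' h = h \<bullet> D" for h
  proof -
    have "f' h = f' (\<Sum>b\<in>Basis. (h \<bullet> b) *\<^sub>R b)" by (simp add: euclidean_representation)
    also have "\<dots> = (\<Sum>b\<in>Basis. (h \<bullet> b) * f' b)" by (simp add: f'.sum f'.scaleR)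
    also have "\<dots> = h \<bullet> D" by (simp add: D_def inner_sum_right mult.commute)
    finally show ?thesis .
  qed
  then have "f' = (\<lambda>h. h \<bullet> D)" by auto
  with f' have "GDERIV f x :> D" by (simp add: gderiv_def)
  moreover have "E = D" if "GDERIV f x :> E" for E
  proof -
    have "(\<lambda>h. h \<bullet> E) = (\<lambda>h. h \<bullet> D)"
      using that \<open>GDERIV f x :> D\<close> unfolding gderiv_def by (rule has_derivative_unique)
    then have "h \<bullet> E = h \<bullet> D" for h by metis
    then show ?thesis by (metis inner_commute vector_eq_rdot)
  qed
  ultimately show ?thesis by blast
qed

text \<open>A remainder that is small compared with the displacement is small compared with
  \<open>h n\<close>, since the displacement is of order \<open>h n\<close>. Sequences are used
  because dominated convergence is sequential.\<close>

lemma has_derivative_remainder_tendsto: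
  fixes \<phi> :: "'a::real_normed_vector \<Rightarrow> 'b::real_normed_vector"
  assumes \<phi>: "(\<phi> has_derivative D) (at x)"
    and y: "\<And>n. norm (y n - x) \<le> C * \<bar>h n\<bar>"
    and h: "h \<longlonglongrightarrow> 0" "\<And>n. h n \<noteq> 0"
  shows "(\<lambda>n. (\<phi> (y n) - \<phi> x - D (y n - x)) /\<^sub>R h n) \<longlonglongrightarrow> 0"
proof (rule LIMSEQ_I)
  fix e :: real assume "0 < e"
  have "0 \<le> C * \<bar>h 0\<bar>" using y[of 0] norm_ge_zero order_trans by blast
  then have C: "0 \<le> C" using h(2)[of 0] by (simp add: zero_le_mult_iff)
  have e': "0 < e / (C + 1)" using \<open>0 < e\<close> C by simp
  then obtain d where "0 < d" and d: "\<And>z. norm (z - x) < d \<Longrightarrow> norm (\<phi> z - \<phi> x - D (z - x)) \<le> e / (C + 1) * norm (z - x)"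
    using \<phi> unfolding has_derivative_within_alt by force
  have "0 < d / (C + 1)" using \<open>0 < d\<close> C by simp
  then obtain n0 where n0: "\<And>n. n \<ge> n0 \<Longrightarrow> \<bar>h n\<bar> < d / (C + 1)"
    using LIMSEQ_D[OF h(1)] by fastforce
  have "norm ((\<phi> (y n) - \<phi> x - D (y n - x)) /\<^sub>R h n - 0) < e" if "n \<ge> n0" for n
  proof -
    have hn: "0 < \<bar>h n\<bar>" using h(2) by simp
    have "norm (y n - x) \<le> C * \<bar>h n\<bar>" by (rule y)
    also have "\<dots> \<le> (C + 1) * \<bar>h n\<bar>" by (intro mult_right_mono) auto
    also have "\<dots> < d" using n0[OF that] C by (simp add: pos_less_divide_eq mult.commute)
    finally have "norm (\<phi> (y n) - \<phi> x - D (y n - x)) \<le> e / (C + 1) * norm (y n - x)" by (rule d)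
    also have "\<dots> \<le> e / (C + 1) * (C * \<bar>h n\<bar>)" using e' y by (intro mult_left_mono) auto
    also have "\<dots> < e * \<bar>h n\<bar>"
    proof -
      have "e / (C + 1) * C < e" using C \<open>0 < e\<close> by (simp add: field_simps)
      from mult_strict_right_mono[OF this hn] show ?thesis by (simp add: mult.assoc)
    qed
    finally have "norm (\<phi> (y n) - \<phi> x - D (y n - x)) / \<bar>h n\<bar> < e"
      using hn by (simp add: pos_divide_less_eq)
    then show ?thesis by (simp add: divide_inverse mult.commute)
  qed
  then show "\<exists>n0. \<forall>n\<ge>n0. norm ((\<phi> (y n) - \<phi> x - D (y n - x)) /\<^sub>R h n - 0) < e" by blast
qed

section \<open>Trajectories and adjoint curves\<close>

lemma absolutely_integrable_scaleR_continuous_right: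
  fixes f :: "real \<Rightarrow> real" and g :: "real \<Rightarrow> 'a::euclidean_space"
  assumes "f absolutely_integrable_on {a..b}" "continuous_on {a..b} g"
  shows "(\<lambda>t. f t *\<^sub>R g t) absolutely_integrable_on {a..b}"
proof -
  have "bilinear (\<lambda>(y :: 'a) r. r *\<^sub>R y)"
    by (auto simp: bilinear_def intro!: linearI simp: algebra_simps)
  from absolutely_integrable_bilinear_continuous[OF this assms(2,1)] show ?thesis .
qed

lemma bounded_linear_column: "bounded_linear (column i :: real^'k^'n \<Rightarrow> real^'n)"
  by (intro linear_conv_bounded_linear[THEN iffD1] linearI) (auto simp: column_def vec_eq_iff)

lemma matrix_vector_mult_columns: "A *v c = (\<Sum>i\<in>UNIV. c $ i *\<^sub>R column i A)" for A :: "real^'k^'n"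
  by (simp add: matrix_mult_sum scalar_mult_eq_scaleR)

lemma bilinear_vector_matrix_mult: "bilinear ((v*) :: real^'n \<Rightarrow> real^'m^'n \<Rightarrow> real^'m)"
  unfolding bilinear_def
  by (intro allI conjI linearI)
    (auto simp: vector_matrix_mult_def vec_eq_iff sum.distrib distrib_left distrib_right sum_distrib_left mult_ac)

lemmas bounded_bilinear_vector_matrix_mult =
  bilinear_vector_matrix_mult[unfolded bilinear_conv_bounded_bilinear]

section \<open>Trajectories of one controlled system\<close>

text \<open>The parameter is fixed, so that each parameter is one instance and two of them can be
  compared side by side.\<close>

locale lipschitz_control =
  fixes F0 :: "real^'n \<Rightarrow> 'p \<Rightarrow> real^'n" and F :: "real^'n \<Rightarrow> 'p \<Rightarrow> real^'k^'n" and \<theta> :: 'p and L :: real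
  assumes L_nonneg: "0 \<le> L"
    and lipschitz_drift: "norm (F0 y \<theta> - F0 z \<theta>) \<le> L * norm (y - z)"
    and lipschitz_column: "norm (column i (F y \<theta>) - column i (F z \<theta>)) \<le> L * norm (y - z)"
begin

text \<open>The control is a function and not a class: a sum of classes is represented by the sum of
  representatives up to a null set only, and the equation for \<open>u + h *\<^sub>R v\<close> is
  written with this sum.\<close>

definition velocity :: "(real \<Rightarrow> real^'k) \<Rightarrow> real \<Rightarrow> real^'n \<Rightarrow> real^'n" where
  "velocity w t y = F0 y \<theta> + F y \<theta> *v w t"

lemma continuous_drift: "continuous_on UNIV (\<lambda>y. F0 y \<theta>)"
  using L_nonneg lipschitz_drift
  by (intro lipschitz_on_continuous_on[of L] lipschitz_onI) (auto simp: dist_norm)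

lemma continuous_column: "continuous_on UNIV (\<lambda>y. column i (F y \<theta>))"
  using L_nonneg lipschitz_column
  by (intro lipschitz_on_continuous_on[of L] lipschitz_onI) (auto simp: dist_norm)

lemma norm_control_diff_le:
  "norm (F y \<theta> *v c - F z \<theta> *v c) \<le> L * (\<Sum>i\<in>UNIV. \<bar>c $ i\<bar>) * norm (y - z)"
proof -
  have "norm (F y \<theta> *v c - F z \<theta> *v c) = norm (\<Sum>i\<in>UNIV. c $ i *\<^sub>R (column i (F y \<theta>) - column i (F z \<theta>)))"
    by (simp add: matrix_vector_mult_columns sum_subtractf scaleR_diff_right)
  also have "\<dots> \<le> (\<Sum>i\<in>UNIV. \<bar>c $ i\<bar> * (L * norm (y - z)))"
    by (intro sum_norm_le) (auto intro!: mult_left_mono lipschitz_column)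
  finally show ?thesis by (simp add: sum_distrib_right sum_distrib_left mult_ac)
qed

lemma absolutely_integrable_control:
  fixes w :: "real \<Rightarrow> real^'k"
  assumes "continuous_on {0..1} y" "w absolutely_integrable_on {0..1}"
  shows "(\<lambda>t. F (y t) \<theta> *v w t) absolutely_integrable_on {0..1}"
proof -
  have "(\<lambda>t. w t $ i *\<^sub>R column i (F (y t) \<theta>)) absolutely_integrable_on {0..1}" for i
  proof (rule absolutely_integrable_scaleR_continuous_right)
    show "continuous_on {0..1} (\<lambda>t. column i (F (y t) \<theta>))"
      using continuous_on_compose2[OF continuous_column assms(1)] by simp
    show "(\<lambda>t. w t $ i) absolutely_integrable_on {0..1}"
      using assms(2) by (rule absolutely_integrable_nth)
  qed
  then show ?thesis
    unfolding matrix_vector_mult_columns by (intro absolutely_integrable_sum) auto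
qed

lemma caratheodory_velocity:
  assumes w: "w absolutely_integrable_on {0..1}" and m: "m absolutely_integrable_on {0..1}"
    and le: "\<And>t. t \<in> {0..1} \<Longrightarrow> L * (1 + (\<Sum>i\<in>UNIV. \<bar>w t $ i\<bar>)) \<le> m t"
  shows "caratheodory_lipschitz (velocity w) m"
proof
  fix t :: real and y z :: "real^'n" assume t: "t \<in> {0..1}"
  have "0 \<le> L * (1 + (\<Sum>i\<in>UNIV. \<bar>w t $ i\<bar>))"
    using L_nonneg by (intro mult_nonneg_nonneg add_nonneg_nonneg sum_nonneg) auto
  with le[OF t] show "0 \<le> m t" by linarith
  have "velocity w t y - velocity w t z = (F0 y \<theta> - F0 z \<theta>) + (F y \<theta> *v w t - F z \<theta> *v w t)"
    by (simp add: velocity_def)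
  also have "norm \<dots> \<le> L * norm (y - z) + L * (\<Sum>i\<in>UNIV. \<bar>w t $ i\<bar>) * norm (y - z)"
    by (intro norm_triangle_mono lipschitz_drift norm_control_diff_le)
  also have "\<dots> = L * (1 + (\<Sum>i\<in>UNIV. \<bar>w t $ i\<bar>)) * norm (y - z)"
    by (simp add: algebra_simps)
  also have "\<dots> \<le> m t * norm (y - z)"
    by (intro mult_right_mono le t) simp
  finally show "norm (velocity w t y - velocity w t z) \<le> m t * norm (y - z)" .
next
  fix y :: "real \<Rightarrow> real^'n" assume y: "continuous_on {0..1} y"
  have "(\<lambda>t. F0 (y t) \<theta>) absolutely_integrable_on {0..1}"
    using continuous_on_compose2[OF continuous_drift y] by (intro absolutely_integrable_continuous_real) auto
  then show "(\<lambda>t. velocity w t (y t)) absolutely_integrable_on {0..1}"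
    unfolding velocity_def by (intro set_integral_add(1) absolutely_integrable_control[OF y w])
qed (use m in auto)

text \<open>\<open>c\<close> is 1 for the full velocity and 0 for the contribution of
  \<open>F\<close> alone.\<close>

lemma absolutely_integrable_rate:
  fixes w :: "real \<Rightarrow> real^'k"
  assumes "w absolutely_integrable_on {0..1}"
  shows "(\<lambda>t. L * (c + (\<Sum>i\<in>UNIV. \<bar>w t $ i\<bar>))) absolutely_integrable_on {0..1}"
proof -
  have "(\<lambda>t. \<bar>w t $ i\<bar>) absolutely_integrable_on {0..1}" for i
    using absolutely_integrable_norm[OF absolutely_integrable_nth[OF assms, of i]] by (simp add: o_def)
  then have "(\<lambda>t. L *\<^sub>R (c + (\<Sum>i\<in>UNIV. \<bar>w t $ i\<bar>))) absolutely_integrable_on {0..1}"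
    by (intro absolutely_integrable_scaleR_left set_integral_add(1) absolutely_integrable_sum absolutely_integrable_on_const) auto
  then show ?thesis by simp
qed

lemma absolutely_integrable_rep_L2: "rep_L2 (u :: 'k L2) absolutely_integrable_on {0..1}"
  by (intro square_integrable_imp_absolutely_integrable square_integrable_rep_L2)

lemma caratheodory_rep_L2:
  "caratheodory_lipschitz (velocity (rep_L2 u)) (\<lambda>t. L * (1 + (\<Sum>i\<in>UNIV. \<bar>rep_L2 u t $ i\<bar>)))"
  by (intro caratheodory_velocity absolutely_integrable_rep_L2 absolutely_integrable_rate) auto

lemma is_trajectory_trajectory: "is_trajectory F0 F \<xi> \<theta> u (trajectory F0 F \<xi> \<theta> u)"
proof -
  interpret caratheodory_lipschitz "velocity (rep_L2 u)" "\<lambda>t. L * (1 + (\<Sum>i\<in>UNIV. \<bar>rep_L2 u t $ i\<bar>))"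
    by (rule caratheodory_rep_L2)
  have "\<exists>!x. is_trajectory F0 F \<xi> \<theta> u x"
    using initial_value_problem[of "\<xi> \<theta>"] unfolding is_trajectory_def velocity_def .
  then show ?thesis unfolding trajectory_def by (rule theI')
qed

text \<open>The control may be replaced by any integrable function that agrees with it almost
  everywhere, in particular by a combination of two representatives.\<close>

lemma trajectory_integral_equation:
  assumes w: "w absolutely_integrable_on {0..1}" "AE t in lebesgue_on {0..1}. rep_L2 u t = w t"
  shows "continuous_on {0..1} (trajectory F0 F \<xi> \<theta> u)"
    and "\<And>t. t \<in> {0..1} \<Longrightarrow> trajectory F0 F \<xi> \<theta> u t =
      \<xi> \<theta> + integral {0..t} (\<lambda>s. velocity w s (trajectory F0 F \<xi> \<theta> u s))"
proof -
  let ?x = "trajectory F0 F \<xi> \<theta> u"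
  interpret caratheodory_lipschitz "velocity w" "\<lambda>t. L * (1 + (\<Sum>i\<in>UNIV. \<bar>w t $ i\<bar>))"
    by (intro caratheodory_velocity w(1) absolutely_integrable_rate) auto
  have x: "absolutely_continuous_curve ?x" "?x 0 = \<xi> \<theta>"
    "AE t in lebesgue_on {0..1}. (?x has_vector_derivative F0 (?x t) \<theta> + F (?x t) \<theta> *v rep_L2 u t) (at t within {0..1})"
    using is_trajectory_trajectory[of \<xi> u] by (auto simp: is_trajectory_def)
  have "AE t in lebesgue_on {0..1}. (?x has_vector_derivative velocity w t (?x t)) (at t within {0..1})"
    using x(3) w(2) by eventually_elim (simp add: velocity_def)
  with x integral_equation_iff[of ?x "\<xi> \<theta>"]
  have *: "continuous_on {0..1} ?x \<and> (\<forall>t\<in>{0..1}. ?x t = \<xi> \<theta> + integral {0..t} (\<lambda>s. velocity w s (?x s)))"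
    by blast
  then show "continuous_on {0..1} ?x" by blast
  show "?x t = \<xi> \<theta> + integral {0..t} (\<lambda>s. velocity w s (?x s))" if "t \<in> {0..1}" for t
    using * that by blast
qed

lemmas trajectory_rep_L2_equation = trajectory_integral_equation[OF absolutely_integrable_rep_L2 AE_I2[OF refl]]

text \<open>The trajectory of \<open>u\<close> solves the equation of
  \<open>u + h *\<^sub>R v\<close> up to a defect, which is \<open>h\<close> times the field
  \<open>F\<close> along it applied to \<open>v\<close>; \<open>perturbation_bound\<close> turns the
  integral of this defect into the constant.\<close>

lemma trajectory_lipschitz_in_direction:
  "\<exists>C. \<forall>h\<in>{-1..1}. \<forall>t\<in>{0..1}.
    norm (trajectory F0 F \<xi> \<theta> (u + h *\<^sub>R v) t - trajectory F0 F \<xi> \<theta> u t) \<le> C * \<bar>h\<bar>"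
proof -
  let ?x = "trajectory F0 F \<xi> \<theta> u"
  \<comment> \<open>One rate for all \<open>h\<close> in \<open>{-1..1}\<close>, since |u + h v| is
    at most |u| + |v| in each component.\<close>
  define m where "m = (\<lambda>t. L * (1 + (\<Sum>i\<in>UNIV. \<bar>rep_L2 u t $ i\<bar>)) + L * (0 + (\<Sum>i\<in>UNIV. \<bar>rep_L2 v t $ i\<bar>)))"
  have m: "m absolutely_integrable_on {0..1}"
    unfolding m_def by (intro set_integral_add(1) absolutely_integrable_rate absolutely_integrable_rep_L2)
  note x = trajectory_rep_L2_equation[where \<xi> = \<xi> and u = u]
  define r where "r = (\<lambda>t. norm (F (?x t) \<theta> *v rep_L2 v t))"
  have "(\<lambda>t. F (?x t) \<theta> *v rep_L2 v t) absolutely_integrable_on {0..1}"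
    by (intro absolutely_integrable_control x absolutely_integrable_rep_L2)
  then have r: "r integrable_on {0..1}"
    unfolding r_def by (simp add: absolutely_integrable_on_def)
  have "norm (trajectory F0 F \<xi> \<theta> (u + h *\<^sub>R v) t - ?x t) \<le> 2 * (norm (\<xi> \<theta> - \<xi> \<theta>) + integral {0..1} (\<lambda>s. \<bar>h\<bar> * r s)) * exp_weight m 1"
    if h: "h \<in> {-1..1}" and t: "t \<in> {0..1}" for h t
  proof -
    define w where "w = (\<lambda>t. rep_L2 u t + h *\<^sub>R rep_L2 v t)"
    have w: "w absolutely_integrable_on {0..1}"
      unfolding w_def by (intro set_integral_add(1) absolutely_integrable_scaleR_left absolutely_integrable_rep_L2)
    have "L * (1 + (\<Sum>i\<in>UNIV. \<bar>w t $ i\<bar>)) \<le> m t" for t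
    proof -
      have "\<bar>w t $ i\<bar> \<le> \<bar>rep_L2 u t $ i\<bar> + \<bar>rep_L2 v t $ i\<bar>" for i
      proof -
        have "\<bar>h * rep_L2 v t $ i\<bar> \<le> 1 * \<bar>rep_L2 v t $ i\<bar>"
          unfolding abs_mult using h by (intro mult_right_mono) auto
        then show ?thesis by (simp add: w_def)
      qed
      then have "1 + (\<Sum>i\<in>UNIV. \<bar>w t $ i\<bar>) \<le> 1 + (\<Sum>i\<in>UNIV. \<bar>rep_L2 u t $ i\<bar> + \<bar>rep_L2 v t $ i\<bar>)"
        by (intro add_left_mono sum_mono)
      from mult_left_mono[OF this L_nonneg] show ?thesis
        by (simp add: m_def sum.distrib algebra_simps)
    qed
    then interpret caratheodory_lipschitz "velocity w" m
      by (intro caratheodory_velocity w m)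
    have "AE t in lebesgue_on {0..1}. rep_L2 (u + h *\<^sub>R v) t = w t"
      unfolding w_def by (rule rep_L2_add_scaleR)
    note xh = trajectory_integral_equation[OF w this, where \<xi> = \<xi>]
    have *: "(\<lambda>s. velocity (rep_L2 u) s (?x s)) integrable_on {0..1}"
      using caratheodory_lipschitz.integrable_on_subinterval[OF caratheodory_rep_L2 x(1)] by simp
    show ?thesis
    proof (rule perturbation_bound[OF xh x * _ _ t])
      show "(\<lambda>s. \<bar>h\<bar> * r s) integrable_on {0..1}" using r by (rule integrable_on_mult_right)
      show "norm (velocity w s (?x s) - velocity (rep_L2 u) s (?x s)) \<le> \<bar>h\<bar> * r s" for s
        by (simp add: velocity_def w_def r_def matrix_vector_right_distrib matrix_vector_mult_scaleR)
    qed
  qed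
  then have "norm (trajectory F0 F \<xi> \<theta> (u + h *\<^sub>R v) t - ?x t) \<le> (2 * integral {0..1} r * exp_weight m 1) * \<bar>h\<bar>"
    if "h \<in> {-1..1}" "t \<in> {0..1}" for h t
    using that by (simp add: mult_ac)
  then show ?thesis by blast
qed

end

section \<open>The adjoint equation along a trajectory\<close>

locale smooth_control = lipschitz_control F0 F \<theta> L
  for F0 :: "real^'n \<Rightarrow> 'p \<Rightarrow> real^'n" and F :: "real^'n \<Rightarrow> 'p \<Rightarrow> real^'k^'n" and \<theta> :: 'p and L :: real +
  fixes x0 :: "'p \<Rightarrow> real^'n" and a :: "real^'n \<Rightarrow> 'p \<Rightarrow> real"
  assumes C1_drift: "C1_regular (\<lambda>y. F0 y \<theta>)"
    and C1_control: "C1_regular (\<lambda>y. F y \<theta>)"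
    and C1_cost: "C1_regular (\<lambda>y. a y \<theta>)"
begin

abbreviation "x u \<equiv> trajectory F0 F x0 \<theta> u"
abbreviation "J0 y \<equiv> jacobian (\<lambda>y. F0 y \<theta>) (at y)"
abbreviation "J i y \<equiv> jacobian (\<lambda>y. column i (F y \<theta>)) (at y)"

lemma C1_column: "C1_regular (\<lambda>y. column i (F y \<theta>))"
  using C1_regular_bounded_linear_compose[OF bounded_linear_column C1_control] .

lemma continuous_trajectory: "continuous_on {0..1} (x u)"
  by (rule trajectory_rep_L2_equation)

lemma continuous_J0: "continuous_on {0..1} (\<lambda>t. J0 (x u t))"
  using continuous_on_compose2[OF C1_regular_jacobian(2)[OF C1_drift] continuous_trajectory] by simp

lemma continuous_J: "continuous_on {0..1} (\<lambda>t. J i (x u t))"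
  using continuous_on_compose2[OF C1_regular_jacobian(2)[OF C1_column] continuous_trajectory] by simp

definition adjoint_velocity :: "'k L2 \<Rightarrow> real \<Rightarrow> real^'n \<Rightarrow> real^'n" where
  "adjoint_velocity u t p = - (p v* (J0 (x u t) + (\<Sum>i\<in>UNIV. (rep_L2 u t $ i) *\<^sub>R J i (x u t))))"

text \<open>The equation is linear. Its coefficient matrix is a sum of Jacobians, continuous along
  the trajectory, with factors 1 and \<open>rep_L2 u t $ i\<close>, and is hence integrable.\<close>

lemma caratheodory_adjoint: "\<exists>m. caratheodory_lipschitz (adjoint_velocity u) m"
proof -
  interpret vm: bounded_bilinear "(v*) :: real^'n \<Rightarrow> real^'n^'n \<Rightarrow> real^'n"
    by (rule bounded_bilinear_vector_matrix_mult)
  obtain K where K: "0 < K" "\<And>p (A :: real^'n^'n). norm (p v* A) \<le> norm p * norm A * K"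
    using vm.pos_bounded by blast
  define m where "m = (\<lambda>t. K *\<^sub>R (norm (J0 (x u t)) + (\<Sum>i\<in>UNIV. norm (J i (x u t)) *\<^sub>R \<bar>rep_L2 u t $ i\<bar>)))"
  have "caratheodory_lipschitz (adjoint_velocity u) m"
  proof
    have "(\<lambda>t. \<bar>rep_L2 u t $ i\<bar>) absolutely_integrable_on {0..1}" for i
      using absolutely_integrable_norm[OF absolutely_integrable_nth[OF absolutely_integrable_rep_L2[of u], of i]]
      by (simp add: o_def)
    then have "(\<lambda>t. norm (J i (x u t)) *\<^sub>R \<bar>rep_L2 u t $ i\<bar>) absolutely_integrable_on {0..1}" for i
      by (intro absolutely_integrable_scaleR_continuous continuous_on_norm continuous_J)
    moreover have "(\<lambda>t. norm (J0 (x u t))) absolutely_integrable_on {0..1}"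
      by (intro absolutely_integrable_continuous_real continuous_on_norm continuous_J0)
    ultimately show "m absolutely_integrable_on {0..1}"
      unfolding m_def
      by (intro absolutely_integrable_scaleR_left set_integral_add(1) absolutely_integrable_sum) auto
    show "0 \<le> m t" for t
      using K by (auto simp: m_def intro!: mult_nonneg_nonneg add_nonneg_nonneg sum_nonneg)
    show "norm (adjoint_velocity u t p - adjoint_velocity u t q) \<le> m t * norm (p - q)" for t p q
    proof -
      let ?A = "J0 (x u t) + (\<Sum>i\<in>UNIV. (rep_L2 u t $ i) *\<^sub>R J i (x u t))"
      have "norm (adjoint_velocity u t p - adjoint_velocity u t q) = norm ((p - q) v* ?A)"
        by (simp add: adjoint_velocity_def vm.diff_left norm_minus_commute)
      also have "\<dots> \<le> norm (p - q) * norm ?A * K" by (rule K)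
      also have "\<dots> \<le> norm (p - q) * (norm (J0 (x u t)) + (\<Sum>i\<in>UNIV. norm (J i (x u t)) *\<^sub>R \<bar>rep_L2 u t $ i\<bar>)) * K"
      proof (intro mult_right_mono mult_left_mono norm_triangle_mono order_refl)
        show "norm (\<Sum>i\<in>UNIV. (rep_L2 u t $ i) *\<^sub>R J i (x u t)) \<le> (\<Sum>i\<in>UNIV. norm (J i (x u t)) *\<^sub>R \<bar>rep_L2 u t $ i\<bar>)"
          by (rule sum_norm_le) (simp add: mult.commute)
      qed (use K in auto)
      finally show ?thesis by (simp add: m_def mult_ac)
    qed
    show "(\<lambda>t. adjoint_velocity u t (p t)) absolutely_integrable_on {0..1}" if p: "continuous_on {0..1} p" for p
    proof -
      \<comment> \<open>Expanded so that every control component is an integrable scalar in front of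
        a continuous vector.\<close>
      have "adjoint_velocity u t (p t) =
          - 1 *\<^sub>R (p t v* J0 (x u t) + (\<Sum>i\<in>UNIV. rep_L2 u t $ i *\<^sub>R (p t v* J i (x u t))))" for t
        by (simp add: adjoint_velocity_def vm.add_right vm.sum_right vm.scaleR_right)
      moreover have "(\<lambda>t. - 1 *\<^sub>R (p t v* J0 (x u t) + (\<Sum>i\<in>UNIV. rep_L2 u t $ i *\<^sub>R (p t v* J i (x u t)))))
          absolutely_integrable_on {0..1}"
      proof (intro absolutely_integrable_scaleR_left set_integral_add(1) absolutely_integrable_sum)
        show "(\<lambda>t. p t v* J0 (x u t)) absolutely_integrable_on {0..1}"
          by (intro absolutely_integrable_continuous_real vm.continuous_on p continuous_J0)
        show "(\<lambda>t. rep_L2 u t $ i *\<^sub>R (p t v* J i (x u t))) absolutely_integrable_on {0..1}" for i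
        proof (rule absolutely_integrable_scaleR_continuous_right)
          show "continuous_on {0..1} (\<lambda>t. p t v* J i (x u t))"
            by (intro vm.continuous_on p continuous_J)
          show "(\<lambda>t. rep_L2 u t $ i) absolutely_integrable_on {0..1}"
            by (intro absolutely_integrable_nth absolutely_integrable_rep_L2)
        qed
      qed auto
      ultimately show ?thesis by presburger
    qed
  qed
  then show ?thesis by blast
qed

lemma adjoint_curve_exists_unique: "\<exists>!p. is_adjoint_curve F0 F x0 a \<theta> u p"
proof -
  obtain m where "caratheodory_lipschitz (adjoint_velocity u) m" using caratheodory_adjoint by blast
  then interpret caratheodory_lipschitz "adjoint_velocity u" m .
  have "(\<lambda>y. a y \<theta>) differentiable at (x u 1)"
    using C1_cost unfolding C1_regular_def differentiable_def by blast
  then obtain D where D: "GDERIV (\<lambda>y. a y \<theta>) (x u 1) :> D"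
      and D_unique: "\<And>E. GDERIV (\<lambda>y. a y \<theta>) (x u 1) :> E \<Longrightarrow> E = D"
    using gderiv_exists_unique by metis
  then have "GDERIV (\<lambda>y. a y \<theta>) (x u 1) :> E \<longleftrightarrow> E = D" for E by blast
  then have "is_adjoint_curve F0 F x0 a \<theta> u p \<longleftrightarrow> p \<in> extensional {0..1} \<and> absolutely_continuous_curve p \<and>
      (AE t in lebesgue_on {0..1}. (p has_vector_derivative adjoint_velocity u t (p t)) (at t within {0..1})) \<and> p 1 = D" for p
    unfolding is_adjoint_curve_def Let_def adjoint_velocity_def by simp
  then show ?thesis using terminal_value_problem[of D] by simp
qed

lemma is_adjoint_curve_adjoint_curve: "is_adjoint_curve F0 F x0 a \<theta> u (adjoint_curve F0 F x0 a \<theta> u)"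
  unfolding adjoint_curve_def using adjoint_curve_exists_unique by (rule theI')

end

section \<open>The derivative of the terminal cost\<close>

lemma sum_matrix_vector_mult: "(\<Sum>i\<in>S. B i) *v c = (\<Sum>i\<in>S. B i *v c)"
  for B :: "'i \<Rightarrow> real^'k^'n"
  by (induction S rule: infinite_finite_induct) (simp_all add: matrix_vector_mult_add_rdistrib)

text \<open>The majorant for dominated convergence. The increments of \<open>\<phi>\<close> and of
  its linear part are estimated separately, so that the Lipschitz bound suffices and the result does
  not depend on \<open>h\<close>.\<close>

lemma inner_remainder_bound:
  fixes \<phi> :: "real^'n \<Rightarrow> real^'m"
  assumes \<phi>: "norm (\<phi> y - \<phi> x) \<le> L * norm (y - x)" and "0 \<le> L"
    and d: "norm (y - x) \<le> C * \<bar>h\<bar>" and "h \<noteq> 0"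
  shows "\<bar>p \<bullet> ((\<phi> y - \<phi> x - J *v (y - x)) /\<^sub>R h)\<bar> \<le> (norm p * L + norm (p v* J)) * C"
proof -
  have "\<bar>p \<bullet> (\<phi> y - \<phi> x - J *v (y - x))\<bar> = \<bar>p \<bullet> (\<phi> y - \<phi> x) - (p v* J) \<bullet> (y - x)\<bar>"
    by (simp only: inner_diff_right[of p "\<phi> y - \<phi> x" "J *v (y - x)"] dot_lmul_matrix)
  also have "\<dots> \<le> \<bar>p \<bullet> (\<phi> y - \<phi> x)\<bar> + \<bar>(p v* J) \<bullet> (y - x)\<bar>" by (rule abs_triangle_ineq4)
  also have "\<dots> \<le> norm p * norm (\<phi> y - \<phi> x) + norm (p v* J) * norm (y - x)"
    by (intro add_mono Cauchy_Schwarz_ineq2)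
  also have "\<dots> \<le> norm p * (L * norm (y - x)) + norm (p v* J) * norm (y - x)"
    by (intro add_mono mult_left_mono \<phi>) auto
  also have "\<dots> = (norm p * L + norm (p v* J)) * norm (y - x)" by (simp add: algebra_simps)
  also have "\<dots> \<le> (norm p * L + norm (p v* J)) * (C * \<bar>h\<bar>)"
    using \<open>0 \<le> L\<close> by (intro mult_left_mono d) auto
  finally have "\<bar>p \<bullet> (\<phi> y - \<phi> x - J *v (y - x))\<bar> / \<bar>h\<bar> \<le> (norm p * L + norm (p v* J)) * C"
    using \<open>h \<noteq> 0\<close> by (simp add: pos_divide_le_eq mult.assoc)
  then show ?thesis by (simp add: abs_mult divide_inverse mult.commute)
qed

context smooth_control
begin

abbreviation "adj u \<equiv> adjoint_curve F0 F x0 a \<theta> u"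

text \<open>The switching function of control theory: the density, against \<open>v\<close>, of the
  first variation of the terminal cost.\<close>

definition switching :: "'k L2 \<Rightarrow> real \<Rightarrow> real^'k" where
  "switching u t = transpose (F (x u t) \<theta>) *v adj u t"

lemma continuous_adjoint: "continuous_on {0..1} (adj u)"
  using is_adjoint_curve_adjoint_curve[of u] absolutely_continuous_curve_imp_continuous_on
  unfolding is_adjoint_curve_def Let_def by blast

text \<open>Continuity is what places the gradient in L2. It is checked by components because
  continuity of \<open>F\<close> is available column by column.\<close>

lemma continuous_switching: "continuous_on {0..1} (switching u)"
proof (rule continuous_on_vec_componentwise)
  fix i
  have "switching u t $ i = column i (F (x u t) \<theta>) \<bullet> adj u t" for t
    by (simp add: switching_def matrix_vector_mult_def transpose_def column_def inner_vec_def)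
  moreover have "continuous_on {0..1} (\<lambda>t. column i (F (x u t) \<theta>) \<bullet> adj u t)"
    using continuous_on_compose2[OF continuous_column continuous_trajectory]
    by (intro continuous_on_inner continuous_adjoint) auto
  ultimately show "continuous_on {0..1} (\<lambda>t. switching u t $ i)" by simp
qed

definition remainder0 :: "'k L2 \<Rightarrow> 'k L2 \<Rightarrow> real \<Rightarrow> real \<Rightarrow> real^'n" where
  "remainder0 u v h t = (F0 (x (u + h *\<^sub>R v) t) \<theta> - F0 (x u t) \<theta>
      - J0 (x u t) *v (x (u + h *\<^sub>R v) t - x u t)) /\<^sub>R h"

definition remainder :: "'k \<Rightarrow> 'k L2 \<Rightarrow> 'k L2 \<Rightarrow> real \<Rightarrow> real \<Rightarrow> real^'n" where
  "remainder i u v h t = (column i (F (x (u + h *\<^sub>R v) t) \<theta>) - column i (F (x u t) \<theta>)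
      - J i (x u t) *v (x (u + h *\<^sub>R v) t - x u t)) /\<^sub>R h"

text \<open>The derivative of the pairing of \<open>adj u\<close> with the increment of the
  trajectory, divided by \<open>h\<close>. Taking \<open>F\<close> along the perturbed trajectory in
  front of \<open>v\<close> absorbs the mixed second-order term.\<close>

definition duality_rate :: "'k L2 \<Rightarrow> 'k L2 \<Rightarrow> real \<Rightarrow> real \<Rightarrow> real" where
  "duality_rate u v h t = adj u t \<bullet> (F (x (u + h *\<^sub>R v) t) \<theta> *v rep_L2 v t)
     + adj u t \<bullet> remainder0 u v h t
     + (\<Sum>i\<in>UNIV. rep_L2 u t $ i * (adj u t \<bullet> remainder i u v h t))"

text \<open>The pairing of the adjoint with the increment of the trajectory replaces the linearized flow:
  its derivative contains no first-order term in the increment.\<close>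

lemma duality_rate_has_integral:
  assumes "h \<noteq> 0"
  shows "(duality_rate u v h has_integral (adj u 1 \<bullet> (x (u + h *\<^sub>R v) 1 - x u 1)) / h) {0..1}"
proof -
  define y where "y = x (u + h *\<^sub>R v)"
  define p where "p = adj u"
  have adjoint: "absolutely_continuous_curve p"
      "AE t in lebesgue_on {0..1}. (p has_vector_derivative adjoint_velocity u t (p t)) (at t within {0..1})"
    using is_adjoint_curve_adjoint_curve[of u]
    unfolding is_adjoint_curve_def Let_def adjoint_velocity_def p_def by blast+
  have traj: "absolutely_continuous_curve (x w)" "x w 0 = x0 \<theta>"
      "AE t in lebesgue_on {0..1}. (x w has_vector_derivative F0 (x w t) \<theta> + F (x w t) \<theta> *v rep_L2 w t) (at t within {0..1})" for w
    using is_trajectory_trajectory[of x0 w] unfolding is_trajectory_def by blast+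
  have ac: "absolutely_continuous_curve (\<lambda>t. p t \<bullet> (y t - x u t))"
    unfolding y_def by (intro absolutely_continuous_curve_inner absolutely_continuous_curve_diff adjoint traj)
  have "AE t in lebesgue_on {0..1}. ((\<lambda>t. p t \<bullet> (y t - x u t)) has_vector_derivative h * duality_rate u v h t) (at t within {0..1})"
    using adjoint(2) traj(3)[of u] traj(3)[of "u + h *\<^sub>R v"] rep_L2_add_scaleR[of u h v]
  proof eventually_elim
    case (elim t)
    let ?A = "J0 (x u t) + (\<Sum>i\<in>UNIV. (rep_L2 u t $ i) *\<^sub>R J i (x u t))"
    let ?d = "y t - x u t"
    let ?d' = "(F0 (y t) \<theta> + F (y t) \<theta> *v (rep_L2 u t + h *\<^sub>R rep_L2 v t)) - (F0 (x u t) \<theta> + F (x u t) \<theta> *v rep_L2 u t)"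
    have "((\<lambda>t. p t \<bullet> (y t - x u t)) has_vector_derivative p t \<bullet> ?d' + adjoint_velocity u t (p t) \<bullet> ?d) (at t within {0..1})"
      using elim unfolding y_def
      by (intro bounded_bilinear.has_vector_derivative[OF bounded_bilinear_inner] has_vector_derivative_diff) simp_all
    moreover have "p t \<bullet> ?d' + adjoint_velocity u t (p t) \<bullet> ?d = h * duality_rate u v h t"
    proof -
      have A: "?A *v ?d = J0 (x u t) *v ?d + (\<Sum>i\<in>UNIV. rep_L2 u t $ i *\<^sub>R (J i (x u t) *v ?d))"
        by (simp add: matrix_vector_mult_add_rdistrib sum_matrix_vector_mult flip: scaleR_matrix_vector_assoc)
      have "adjoint_velocity u t (p t) \<bullet> ?d = - (p t \<bullet> (?A *v ?d))"
        by (simp add: adjoint_velocity_def dot_lmul_matrix)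
      \<comment> \<open>Removing the linearization \<open>?A *v ?d\<close> leaves the Taylor
        remainders and the term from the direction \<open>v\<close>; the adjoint equation performs
        this subtraction.\<close>
      moreover have "?d' - ?A *v ?d = (F0 (y t) \<theta> - F0 (x u t) \<theta> - J0 (x u t) *v ?d)
          + (\<Sum>i\<in>UNIV. rep_L2 u t $ i *\<^sub>R (column i (F (y t) \<theta>) - column i (F (x u t) \<theta>) - J i (x u t) *v ?d))
          + h *\<^sub>R (F (y t) \<theta> *v rep_L2 v t)"
        unfolding A
        by (simp add: matrix_vector_right_distrib matrix_vector_mult_scaleR
            matrix_vector_mult_columns[of _ "rep_L2 u t"] scaleR_diff_right sum_subtractf)
      moreover have "F0 (y t) \<theta> - F0 (x u t) \<theta> - J0 (x u t) *v ?d = h *\<^sub>R remainder0 u v h t"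
        using assms by (simp add: remainder0_def y_def)
      moreover have "column i (F (y t) \<theta>) - column i (F (x u t) \<theta>) - J i (x u t) *v ?d = h *\<^sub>R remainder i u v h t" for i
        using assms by (simp add: remainder_def y_def)
      ultimately have "p t \<bullet> ?d' + adjoint_velocity u t (p t) \<bullet> ?d =
          p t \<bullet> (h *\<^sub>R remainder0 u v h t + (\<Sum>i\<in>UNIV. rep_L2 u t $ i *\<^sub>R (h *\<^sub>R remainder i u v h t))
            + h *\<^sub>R (F (y t) \<theta> *v rep_L2 v t))"
        by (simp only: inner_diff_right[symmetric] diff_conv_add_uminus[symmetric])
      also have "\<dots> = h * duality_rate u v h t"
        by (simp add: duality_rate_def p_def y_def inner_add_right inner_sum_right distrib_left sum_distrib_left mult_ac)
      finally show ?thesis .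
    qed
    ultimately show ?case by simp
  qed
  from absolutely_continuous_curve_has_integral[OF ac this, of 0 1]
  \<comment> \<open>At time 0 the pairing vanishes, the two trajectories having the same initial
    point.\<close>
  have "((\<lambda>t. h * duality_rate u v h t) has_integral (p 1 \<bullet> (y 1 - x u 1))) {0..1}"
    by (simp add: y_def traj(2))
  from has_integral_mult_right[OF this, of "1 / h"] show ?thesis
    using assms by (simp add: p_def y_def)
qed

text \<open>Dominated convergence. The remainders disappear in the limit, and \<open>F\<close>
  passes to the covector as its transpose.\<close>

lemma integral_duality_rate_tendsto:
  assumes h: "\<And>n. h n \<in> {-1..1} - {0}" "h \<longlonglongrightarrow> 0"
  shows "(\<lambda>n. integral {0..1} (duality_rate u v (h n))) \<longlonglongrightarrow> integral {0..1} (\<lambda>t. switching u t \<bullet> rep_L2 v t)"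
proof -
  define p where "p = adj u"
  define y where "y = (\<lambda>n. x (u + h n *\<^sub>R v))"
  have h0: "h n \<noteq> 0" "\<bar>h n\<bar> \<le> 1" for n using h(1)[of n] by auto
  obtain C where "\<forall>h\<in>{-1..1}. \<forall>t\<in>{0..1}. norm (x (u + h *\<^sub>R v) t - x u t) \<le> C * \<bar>h\<bar>"
    using trajectory_lipschitz_in_direction[of x0 u v] by blast
  then have C: "norm (y n t - x u t) \<le> C * \<bar>h n\<bar>" if "t \<in> {0..1}" for n t
    using h(1)[of n] that unfolding y_def by blast
  have "0 \<le> C * \<bar>h 0\<bar>" by (rule order_trans[OF norm_ge_zero C[of 0]]) simp
  then have C0: "0 \<le> C" using h0[of 0] by (simp add: zero_le_mult_iff)
  have rem0: "\<bar>p t \<bullet> remainder0 u v (h n) t\<bar> \<le> (norm (p t) * L + norm (p t v* J0 (x u t))) * C" if "t \<in> {0..1}" for t n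
    unfolding remainder0_def using C[OF that, of n] h0[of n]
    by (intro inner_remainder_bound[where \<phi> = "\<lambda>y. F0 y \<theta>"] lipschitz_drift L_nonneg) (auto simp: y_def)
  have rem: "\<bar>p t \<bullet> remainder i u v (h n) t\<bar> \<le> (norm (p t) * L + norm (p t v* J i (x u t))) * C" if "t \<in> {0..1}" for t n i
    unfolding remainder_def using C[OF that, of n] h0[of n]
    by (intro inner_remainder_bound[where \<phi> = "\<lambda>y. column i (F y \<theta>)"] lipschitz_column L_nonneg) (auto simp: y_def)
  \<comment> \<open>One summand for each summand of \<open>duality_rate\<close>. In the first,
    \<open>F\<close> along the perturbed trajectory is compared with \<open>F\<close> along that of
    \<open>u\<close>; as |h| is at most 1, their distance is at most \<open>C\<close>.\<close>
  define b where "b = (\<lambda>t. norm (p t) * (norm (F (x u t) \<theta> *v rep_L2 v t) + C * (L * (0 + (\<Sum>i\<in>UNIV. \<bar>rep_L2 v t $ i\<bar>))))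
      + (norm (p t) * L + norm (p t v* J0 (x u t))) * C
      + (\<Sum>i\<in>UNIV. (norm (p t) * L + norm (p t v* J i (x u t))) * C * \<bar>rep_L2 u t $ i\<bar>))"
  have p: "continuous_on {0..1} p" unfolding p_def by (rule continuous_adjoint)
  note vm = bounded_bilinear.continuous_on[OF bounded_bilinear_vector_matrix_mult]
  have "b absolutely_integrable_on {0..1}"
    unfolding b_def
  proof (intro set_integral_add(1) absolutely_integrable_sum)
    show "(\<lambda>t. norm (p t) * (norm (F (x u t) \<theta> *v rep_L2 v t) + C * (L * (0 + (\<Sum>i\<in>UNIV. \<bar>rep_L2 v t $ i\<bar>)))))
        absolutely_integrable_on {0..1}"
    proof (rule absolutely_integrable_mult_continuous)
      have "(\<lambda>t. norm (F (x u t) \<theta> *v rep_L2 v t)) absolutely_integrable_on {0..1}"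
        using absolutely_integrable_norm[OF absolutely_integrable_control[OF continuous_trajectory absolutely_integrable_rep_L2]]
        by (simp add: o_def)
      moreover have "(\<lambda>t. C *\<^sub>R (L * (0 + (\<Sum>i\<in>UNIV. \<bar>rep_L2 v t $ i\<bar>)))) absolutely_integrable_on {0..1}"
        by (intro absolutely_integrable_scaleR_left absolutely_integrable_rate absolutely_integrable_rep_L2)
      ultimately show "(\<lambda>t. norm (F (x u t) \<theta> *v rep_L2 v t) + C * (L * (0 + (\<Sum>i\<in>UNIV. \<bar>rep_L2 v t $ i\<bar>))))
          absolutely_integrable_on {0..1}"
        by (intro set_integral_add(1)) auto
    qed (intro continuous_intros p)
    show "(\<lambda>t. (norm (p t) * L + norm (p t v* J0 (x u t))) * C) absolutely_integrable_on {0..1}"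
      by (intro absolutely_integrable_continuous_real continuous_intros p vm continuous_J0)
    show "(\<lambda>t. (norm (p t) * L + norm (p t v* J i (x u t))) * C * \<bar>rep_L2 u t $ i\<bar>) absolutely_integrable_on {0..1}" for i
    proof (rule absolutely_integrable_mult_continuous)
      show "continuous_on {0..1} (\<lambda>t. (norm (p t) * L + norm (p t v* J i (x u t))) * C)"
        by (intro continuous_intros p vm continuous_J)
      show "(\<lambda>t. \<bar>rep_L2 u t $ i\<bar>) absolutely_integrable_on {0..1}"
        using absolutely_integrable_norm[OF absolutely_integrable_nth[OF absolutely_integrable_rep_L2[of u], of i]]
        by (simp add: o_def)
    qed
  qed auto
  then have b: "b integrable_on {0..1}"
    using set_lebesgue_integral_eq_integral(1) by blast
  show ?thesis
  proof (rule dominated_convergence(2)[OF _ b])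
    show "duality_rate u v (h n) integrable_on {0..1}" for n
      using duality_rate_has_integral[OF h0(1)] by blast
    fix n :: nat and t :: real assume t: "t \<in> {0..1}"
    have "\<bar>p t \<bullet> (F (y n t) \<theta> *v rep_L2 v t)\<bar> \<le> norm (p t) * norm (F (y n t) \<theta> *v rep_L2 v t)"
      by (rule Cauchy_Schwarz_ineq2)
    also have "\<dots> \<le> norm (p t) * (norm (F (x u t) \<theta> *v rep_L2 v t) + C * (L * (0 + (\<Sum>i\<in>UNIV. \<bar>rep_L2 v t $ i\<bar>))))"
    proof (rule mult_left_mono)
      have "norm (F (y n t) \<theta> *v rep_L2 v t - F (x u t) \<theta> *v rep_L2 v t) \<le> L * (\<Sum>i\<in>UNIV. \<bar>rep_L2 v t $ i\<bar>) * norm (y n t - x u t)"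
        by (rule norm_control_diff_le)
      also have "\<dots> \<le> L * (\<Sum>i\<in>UNIV. \<bar>rep_L2 v t $ i\<bar>) * C"
      proof (rule mult_left_mono)
        show "norm (y n t - x u t) \<le> C"
          using C[OF t, of n] mult_left_mono[OF h0(2)[of n] C0] by linarith
      qed (intro mult_nonneg_nonneg sum_nonneg L_nonneg abs_ge_zero)
      finally have "norm (F (y n t) \<theta> *v rep_L2 v t - F (x u t) \<theta> *v rep_L2 v t) \<le> C * (L * (0 + (\<Sum>i\<in>UNIV. \<bar>rep_L2 v t $ i\<bar>)))"
        by (simp add: mult_ac)
      then show "norm (F (y n t) \<theta> *v rep_L2 v t) \<le> norm (F (x u t) \<theta> *v rep_L2 v t) + C * (L * (0 + (\<Sum>i\<in>UNIV. \<bar>rep_L2 v t $ i\<bar>)))"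
        using norm_triangle_sub[of "F (y n t) \<theta> *v rep_L2 v t" "F (x u t) \<theta> *v rep_L2 v t"] by linarith
    qed simp
    finally have 1: "\<bar>p t \<bullet> (F (y n t) \<theta> *v rep_L2 v t)\<bar> \<le> \<dots>" .
    have 2: "\<bar>\<Sum>i\<in>UNIV. rep_L2 u t $ i * (p t \<bullet> remainder i u v (h n) t)\<bar>
        \<le> (\<Sum>i\<in>UNIV. (norm (p t) * L + norm (p t v* J i (x u t))) * C * \<bar>rep_L2 u t $ i\<bar>)"
      by (rule order_trans[OF sum_abs sum_mono])
        (use mult_left_mono[OF rem[OF t] abs_ge_zero] in \<open>simp add: abs_mult mult.commute\<close>)
    show "norm (duality_rate u v (h n) t) \<le> b t"
      using 1 rem0[OF t, of n] 2 unfolding duality_rate_def b_def real_norm_def p_def[symmetric] y_def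
      by (intro order_trans[OF abs_triangle_ineq] add_mono) auto
  next
    fix t :: real assume t: "t \<in> {0..1}"
    have hC: "(\<lambda>n. C * \<bar>h n\<bar>) \<longlonglongrightarrow> 0"
      using tendsto_mult_left[OF tendsto_rabs[OF h(2)], of C] by simp
    have lim: "(\<lambda>n. F (y n t) \<theta> *v rep_L2 v t) \<longlonglongrightarrow> F (x u t) \<theta> *v rep_L2 v t"
    proof (rule LIM_zero_cancel, rule Lim_null_comparison[OF always_eventually])
      show "\<forall>n. norm (F (y n t) \<theta> *v rep_L2 v t - F (x u t) \<theta> *v rep_L2 v t)
          \<le> L * (\<Sum>i\<in>UNIV. \<bar>rep_L2 v t $ i\<bar>) * (C * \<bar>h n\<bar>)"
        using L_nonneg
        by (intro allI order_trans[OF norm_control_diff_le mult_left_mono[OF C[OF t]]] mult_nonneg_nonneg sum_nonneg) auto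
      show "(\<lambda>n. L * (\<Sum>i\<in>UNIV. \<bar>rep_L2 v t $ i\<bar>) * (C * \<bar>h n\<bar>)) \<longlonglongrightarrow> 0"
        using tendsto_mult_left[OF hC] by fastforce
    qed
    have lim0: "(\<lambda>n. remainder0 u v (h n) t) \<longlonglongrightarrow> 0"
      unfolding remainder0_def
      by (rule has_derivative_remainder_tendsto[OF C1_regular_jacobian(1)[OF C1_drift] C[OF t, unfolded y_def] h(2) h0(1)])
    have limi: "(\<lambda>n. remainder i u v (h n) t) \<longlonglongrightarrow> 0" for i
      unfolding remainder_def
      by (rule has_derivative_remainder_tendsto[OF C1_regular_jacobian(1)[OF C1_column] C[OF t, unfolded y_def] h(2) h0(1)])
    have "(\<lambda>n. p t \<bullet> (F (y n t) \<theta> *v rep_L2 v t) + p t \<bullet> remainder0 u v (h n) t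
        + (\<Sum>i\<in>UNIV. rep_L2 u t $ i * (p t \<bullet> remainder i u v (h n) t)))
      \<longlonglongrightarrow> p t \<bullet> (F (x u t) \<theta> *v rep_L2 v t) + p t \<bullet> 0 + (\<Sum>i\<in>UNIV. rep_L2 u t $ i * (p t \<bullet> 0))"
      by (intro tendsto_intros lim lim0 limi)
    then show "(\<lambda>n. duality_rate u v (h n) t) \<longlonglongrightarrow> switching u t \<bullet> rep_L2 v t"
      by (simp add: duality_rate_def switching_def dot_lmul_matrix p_def y_def)
  qed
qed

text \<open>The Taylor remainder of the terminal cost is o(h) by the Lipschitz estimate, and its
  linear part, the pairing with the gradient \<open>adj u 1\<close>, is \<open>h\<close> times the
  integral of \<open>duality_rate\<close>.\<close>

theorem terminal_cost_derivative:
  "((\<lambda>h. (a (x (u + h *\<^sub>R v) 1) \<theta> - a (x u 1) \<theta>) / h)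
     \<longlongrightarrow> integral {0..1} (\<lambda>t. switching u t \<bullet> rep_L2 v t)) (at 0)"
proof -
  \<comment> \<open>The uniform estimate holds for \<open>h\<close> in \<open>{-1..1}\<close>; as 0
    is interior, the limit restricted to this interval is the full limit.\<close>
  have "at (0 :: real) within {-1..1} = at 0" by (rule at_within_interior) simp
  moreover have "((\<lambda>h. (a (x (u + h *\<^sub>R v) 1) \<theta> - a (x u 1) \<theta>) / h)
     \<longlongrightarrow> integral {0..1} (\<lambda>t. switching u t \<bullet> rep_L2 v t)) (at 0 within {-1..1})"
    unfolding tendsto_at_iff_sequentially
  proof (intro allI impI)
    fix h :: "nat \<Rightarrow> real" assume "\<forall>n. h n \<in> {-1..1} - {0}" and lim: "h \<longlonglongrightarrow> 0"
    then have h: "\<And>n. h n \<in> {-1..1} - {0}" and h0: "\<And>n. h n \<noteq> 0" by auto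
    obtain C where "\<forall>h\<in>{-1..1}. \<forall>t\<in>{0..1}. norm (x (u + h *\<^sub>R v) t - x u t) \<le> C * \<bar>h\<bar>"
      using trajectory_lipschitz_in_direction[of x0 u v] by blast
    then have C: "norm (x (u + h n *\<^sub>R v) 1 - x u 1) \<le> C * \<bar>h n\<bar>" for n
      using h[of n] by auto
    have "GDERIV (\<lambda>y. a y \<theta>) (x u 1) :> adj u 1"
      using is_adjoint_curve_adjoint_curve[of u] unfolding is_adjoint_curve_def Let_def by blast
    then have "((\<lambda>y. a y \<theta>) has_derivative (\<lambda>d. d \<bullet> adj u 1)) (at (x u 1))"
      by (simp add: gderiv_def)
    from has_derivative_remainder_tendsto[OF this C lim h0]
    have "(\<lambda>n. (a (x (u + h n *\<^sub>R v) 1) \<theta> - a (x u 1) \<theta> - (x (u + h n *\<^sub>R v) 1 - x u 1) \<bullet> adj u 1) /\<^sub>R h n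
        + integral {0..1} (duality_rate u v (h n))) \<longlonglongrightarrow> 0 + integral {0..1} (\<lambda>t. switching u t \<bullet> rep_L2 v t)"
      by (intro tendsto_add integral_duality_rate_tendsto[OF h lim])
    moreover have "integral {0..1} (duality_rate u v (h n)) = ((x (u + h n *\<^sub>R v) 1 - x u 1) \<bullet> adj u 1) / h n" for n
      using integral_unique[OF duality_rate_has_integral[OF h0]] by (simp add: inner_commute)
    ultimately show "((\<lambda>h. (a (x (u + h *\<^sub>R v) 1) \<theta> - a (x u 1) \<theta>) / h) \<circ> h)
        \<longlonglongrightarrow> integral {0..1} (\<lambda>t. switching u t \<bullet> rep_L2 v t)"
      by (simp add: o_def divide_inverse algebra_simps)
  qed
  ultimately show ?thesis by simp
qed

end

section \<open>The ensemble cost\<close>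

text \<open>This makes the integrand of the ensemble cost measurable. The trajectory of \<eta> has
  in the equation of \<theta> a defect of at most \<open>norm (\<theta> - \<eta>) * m s\<close>,
  uniformly in the state.\<close>

lemma trajectory_continuous_in_parameter:
  fixes F0 :: "real^'n \<Rightarrow> 'p::real_normed_vector \<Rightarrow> real^'n" and F :: "real^'n \<Rightarrow> 'p \<Rightarrow> real^'k^'n"
  assumes "0 \<le> L"
    and F0: "\<And>y z \<theta> \<eta>. \<theta> \<in> \<Theta> \<Longrightarrow> \<eta> \<in> \<Theta> \<Longrightarrow> norm (F0 y \<theta> - F0 z \<eta>) \<le> L * (norm (y - z) + norm (\<theta> - \<eta>))"
    and F: "\<And>i y z \<theta> \<eta>. \<theta> \<in> \<Theta> \<Longrightarrow> \<eta> \<in> \<Theta> \<Longrightarrow>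
      norm (column i (F y \<theta>) - column i (F z \<eta>)) \<le> L * (norm (y - z) + norm (\<theta> - \<eta>))"
    and x0: "continuous_on \<Theta> x0" and t: "t \<in> {0..1}"
  shows "continuous_on \<Theta> (\<lambda>\<theta>. trajectory F0 F x0 \<theta> u t)"
  unfolding continuous_on_def
proof
  fix \<eta> assume \<eta>: "\<eta> \<in> \<Theta>"
  have control: "lipschitz_control F0 F \<theta> L" if "\<theta> \<in> \<Theta>" for \<theta>
    using \<open>0 \<le> L\<close> F0[OF that that] F[OF that that] by unfold_locales auto
  \<comment> \<open>This function serves twice: as Lipschitz rate in the state for every parameter,
    and as the defect per unit of parameter distance.\<close>
  define m where "m = (\<lambda>t. L * (1 + (\<Sum>i\<in>UNIV. \<bar>rep_L2 u t $ i\<bar>)))"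
  interpret lipschitz_control F0 F \<eta> L by (rule control[OF \<eta>])
  have bound: "norm (trajectory F0 F x0 \<theta> u t - trajectory F0 F x0 \<eta> u t)
      \<le> 2 * (norm (x0 \<theta> - x0 \<eta>) + norm (\<theta> - \<eta>) * integral {0..1} m) * exp_weight m 1" if \<theta>: "\<theta> \<in> \<Theta>" for \<theta>
  proof -
    interpret \<theta>: lipschitz_control F0 F \<theta> L by (rule control[OF \<theta>])
    interpret \<theta>: caratheodory_lipschitz "\<theta>.velocity (rep_L2 u)" m
      unfolding m_def by (rule \<theta>.caratheodory_rep_L2)
    note x = trajectory_rep_L2_equation[where \<xi> = x0 and u = u]
    note y = \<theta>.trajectory_rep_L2_equation[where \<xi> = x0 and u = u]
    have int: "(\<lambda>s. velocity (rep_L2 u) s (trajectory F0 F x0 \<eta> u s)) integrable_on {0..1}"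
      using caratheodory_lipschitz.integrable_on_subinterval[OF caratheodory_rep_L2 x(1)] by simp
    have "m integrable_on {0..1}"
      using \<theta>.m(1) set_lebesgue_integral_eq_integral(1) by blast
    then have m: "(\<lambda>s. norm (\<theta> - \<eta>) * m s) integrable_on {0..1}" by (rule integrable_on_mult_right)
    have diff: "norm (\<theta>.velocity (rep_L2 u) s z - velocity (rep_L2 u) s z) \<le> norm (\<theta> - \<eta>) * m s" for s z
    proof -
      have "\<theta>.velocity (rep_L2 u) s z - velocity (rep_L2 u) s z =
          (F0 z \<theta> - F0 z \<eta>) + (\<Sum>i\<in>UNIV. rep_L2 u s $ i *\<^sub>R (column i (F z \<theta>) - column i (F z \<eta>)))"
        by (simp add: \<theta>.velocity_def velocity_def matrix_vector_mult_columns sum_subtractf scaleR_diff_right)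
      also have "norm \<dots> \<le> L * norm (\<theta> - \<eta>) + (\<Sum>i\<in>UNIV. \<bar>rep_L2 u s $ i\<bar> * (L * norm (\<theta> - \<eta>)))"
      proof (intro norm_triangle_mono sum_norm_le)
        show "norm (F0 z \<theta> - F0 z \<eta>) \<le> L * norm (\<theta> - \<eta>)" using F0[OF \<theta> \<eta>, of z z] by simp
        show "norm (rep_L2 u s $ i *\<^sub>R (column i (F z \<theta>) - column i (F z \<eta>))) \<le> \<bar>rep_L2 u s $ i\<bar> * (L * norm (\<theta> - \<eta>))" for i
          using F[OF \<theta> \<eta>, of i z z] by (simp add: mult_left_mono)
      qed
      finally show ?thesis by (simp add: m_def algebra_simps sum_distrib_left)
    qed
    have "norm (trajectory F0 F x0 \<theta> u t - trajectory F0 F x0 \<eta> u t)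
      \<le> 2 * (norm (x0 \<theta> - x0 \<eta>) + integral {0..1} (\<lambda>s. norm (\<theta> - \<eta>) * m s)) * exp_weight m 1"
      by (rule \<theta>.perturbation_bound[OF y x int m diff t])
    then show ?thesis by simp
  qed
  have "((\<lambda>\<theta>. 2 * (norm (x0 \<theta> - x0 \<eta>) + norm (\<theta> - \<eta>) * integral {0..1} m) * exp_weight m 1)
      \<longlongrightarrow> 2 * (norm (x0 \<eta> - x0 \<eta>) + norm (\<eta> - \<eta>) * integral {0..1} m) * exp_weight m 1) (at \<eta> within \<Theta>)"
    using x0 \<eta> by (intro tendsto_intros) (simp add: continuous_on_def)
  then have lim: "((\<lambda>\<theta>. 2 * (norm (x0 \<theta> - x0 \<eta>) + norm (\<theta> - \<eta>) * integral {0..1} m) * exp_weight m 1) \<longlongrightarrow> 0) (at \<eta> within \<Theta>)"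
    by simp
  have "\<forall>\<^sub>F \<theta> in at \<eta> within \<Theta>. norm (trajectory F0 F x0 \<theta> u t - trajectory F0 F x0 \<eta> u t)
      \<le> 2 * (norm (x0 \<theta> - x0 \<eta>) + norm (\<theta> - \<eta>) * integral {0..1} m) * exp_weight m 1"
    using bound by (auto simp: eventually_at_filter)
  from Lim_null_comparison[OF this lim]
  show "((\<lambda>\<theta>. trajectory F0 F x0 \<theta> u t) \<longlongrightarrow> trajectory F0 F x0 \<eta> u t) (at \<eta> within \<Theta>)"
    by (rule LIM_zero_cancel)
qed

section \<open>Integrals against the empirical measure\<close>

text \<open>\<open>measure_of\<close> has the intended values only if the set function is a measure.
  Writing it as the image of a point measure settles this and reduces integrals to finite
  sums.\<close>

lemma empirical_measure_eq_distr:
  assumes \<theta>: "\<And>j. j \<in> {1..N} \<Longrightarrow> \<theta> j \<in> \<Theta>"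
  shows "empirical_measure \<Theta> N \<alpha> \<theta> =
    distr (point_measure {1..N} (\<lambda>j. ennreal (\<alpha> j))) (restrict_space borel \<Theta>) \<theta>"
  unfolding empirical_measure_def distr_def space_restrict_space space_borel Int_UNIV_right
proof (rule measure_of_eq)
  show "sets (restrict_space borel \<Theta>) \<subseteq> Pow \<Theta>"
    using sets.space_closed[of "restrict_space borel \<Theta>"] by (simp add: space_restrict_space)
  fix A
  have "emeasure (point_measure {1..N} (\<lambda>j. ennreal (\<alpha> j))) (\<theta> -` A \<inter> {1..N}) = (\<Sum>j | j \<in> {1..N} \<and> \<theta> j \<in> A. ennreal (\<alpha> j))"
    by (subst emeasure_point_measure_finite) (auto intro!: sum.cong)
  also have "\<dots> = (\<Sum>j=1..N. ennreal (\<alpha> j) * indicator A (\<theta> j))"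
    by (rule sum.mono_neutral_cong_left) (auto simp: indicator_def)
  finally show "(\<Sum>j=1..N. ennreal (\<alpha> j) * indicator A (\<theta> j)) =
      emeasure (point_measure {1..N} (\<lambda>j. ennreal (\<alpha> j))) (\<theta> -` A \<inter> space (point_measure {1..N} (\<lambda>j. ennreal (\<alpha> j))))"
    by (simp add: space_point_measure)
qed

lemma integral_empirical_measure:
  fixes f :: "'p::topological_space \<Rightarrow> real"
  assumes "\<And>j. j \<in> {1..N} \<Longrightarrow> \<theta> j \<in> \<Theta>" "\<And>j. j \<in> {1..N} \<Longrightarrow> 0 \<le> \<alpha> j"
    and f: "f \<in> borel_measurable (restrict_space borel \<Theta>)"
  shows "(\<integral>\<eta>. f \<eta> \<partial>empirical_measure \<Theta> N \<alpha> \<theta>) = (\<Sum>j=1..N. \<alpha> j * f (\<theta> j))"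
proof -
  have eq: "empirical_measure \<Theta> N \<alpha> \<theta> =
      distr (point_measure {1..N} (\<lambda>j. ennreal (\<alpha> j))) (restrict_space borel \<Theta>) \<theta>"
    using assms(1) by (rule empirical_measure_eq_distr)
  have "\<theta> \<in> measurable (point_measure {1..N} (\<lambda>j. ennreal (\<alpha> j))) (restrict_space borel \<Theta>)"
    using assms(1) by (auto simp: measurable_def space_point_measure sets_point_measure space_restrict_space)
  then have "(\<integral>\<eta>. f \<eta> \<partial>empirical_measure \<Theta> N \<alpha> \<theta>) = (\<integral>j. f (\<theta> j) \<partial>point_measure {1..N} (\<lambda>j. ennreal (\<alpha> j)))"
    using f by (simp only: eq integral_distr)
  also have "\<dots> = (\<Sum>j=1..N. \<alpha> j * f (\<theta> j))"
    using assms(2) by (subst lebesgue_integral_point_measure_finite) auto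
  finally show ?thesis .
qed

section \<open>Gateaux derivatives and gradient fields\<close>

lemma has_gateaux_derivative_unique:
  assumes "has_gateaux_derivative J D u" "has_gateaux_derivative J E u"
  shows "D = E"
proof
  fix v
  show "D v = E v"
    using assms unfolding has_gateaux_derivative_def by (blast intro: tendsto_unique[OF at_neq_bot])
qed

lemma gateaux_derivative_eqI:
  assumes "has_gateaux_derivative J D u"
  shows "gateaux_derivative J u = D"
  unfolding gateaux_derivative_def
  using assms by (intro the_equality) (auto intro: has_gateaux_derivative_unique)

text \<open>Once one representing field is exhibited, existence and uniqueness of the gradient field
  and every statement about it reduce to that field.\<close>

lemma gradient_field_unique_iff:
  fixes G :: "'a::real_inner \<Rightarrow> 'a"
  assumes "\<And>u. has_gateaux_derivative J (\<lambda>v. G u \<bullet> v) u"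
  shows "gradient_field J G' \<longleftrightarrow> G' = G"
proof -
  have "gateaux_derivative J u = (\<lambda>v. G u \<bullet> v)" for u
    using assms by (rule gateaux_derivative_eqI)
  then have "gradient_field J G' \<longleftrightarrow> (\<forall>u v. G' u \<bullet> v = G u \<bullet> v)"
    by (simp add: gradient_field_def)
  also have "\<dots> \<longleftrightarrow> G' = G"
    by (auto simp: fun_eq_iff) (metis vector_eq_rdot inner_commute)
  finally show ?thesis .
qed

lemma norm_square_directional_derivative:
  fixes u v :: "'a::real_inner"
  shows "((\<lambda>h. ((norm (u + h *\<^sub>R v))\<^sup>2 - (norm u)\<^sup>2) / h) \<longlongrightarrow> 2 * (u \<bullet> v)) (at 0)"
proof -
  have "((\<lambda>h :: real. 2 * (u \<bullet> v) + h * (v \<bullet> v)) \<longlongrightarrow> 2 * (u \<bullet> v) + 0 * (v \<bullet> v)) (at 0)"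
    by (intro tendsto_intros)
  moreover have "\<forall>\<^sub>F h in at (0 :: real). 2 * (u \<bullet> v) + h * (v \<bullet> v) = ((norm (u + h *\<^sub>R v))\<^sup>2 - (norm u)\<^sup>2) / h"
    unfolding eventually_at_filter
    by (rule always_eventually)
      (auto simp: power2_norm_eq_inner inner_add_left inner_add_right inner_commute field_simps)
  ultimately show ?thesis by (simp add: Lim_transform_eventually)
qed

section \<open>The gradient formula for the ensemble cost\<close>

theorem theorem4p1:
  fixes \<Theta> :: "'p::euclidean_space set"
    and F0 :: "real^'n \<Rightarrow> 'p \<Rightarrow> real^'n"
    and F :: "real^'n \<Rightarrow> 'p \<Rightarrow> real^'k^'n"
    and x0 :: "'p \<Rightarrow> real^'n"
    and a :: "real^'n \<Rightarrow> 'p \<Rightarrow> real"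
    and L \<beta> :: real
    and N :: nat and \<alpha> :: "nat \<Rightarrow> real" and \<theta> :: "nat \<Rightarrow> 'p"
  defines "J \<equiv> ensemble_cost F0 F x0 a \<beta> (empirical_measure \<Theta> N \<alpha> \<theta>)"
  assumes "compact \<Theta>"
    and "L > 0"
    and "\<And>x1 x2 \<theta>1 \<theta>2. \<theta>1 \<in> \<Theta> \<Longrightarrow> \<theta>2 \<in> \<Theta> \<Longrightarrow>
           norm (F0 x1 \<theta>1 - F0 x2 \<theta>2) \<le> L * (norm (x1 - x2) + norm (\<theta>1 - \<theta>2))"
    and "\<And>i x1 x2 \<theta>1 \<theta>2. \<theta>1 \<in> \<Theta> \<Longrightarrow> \<theta>2 \<in> \<Theta> \<Longrightarrow>
           norm (column i (F x1 \<theta>1) - column i (F x2 \<theta>2)) \<le> L * (norm (x1 - x2) + norm (\<theta>1 - \<theta>2))"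
    and "continuous_on \<Theta> x0"
    and "continuous_on (UNIV \<times> \<Theta>) (\<lambda>(x, \<theta>). a x \<theta>)"
    and "\<And>x \<theta>. \<theta> \<in> \<Theta> \<Longrightarrow> 0 \<le> a x \<theta>"
    and "\<beta> > 0"
    and "\<And>\<theta>. \<theta> \<in> \<Theta> \<Longrightarrow> C1_regular (\<lambda>x. F0 x \<theta>)"
    and "\<And>\<theta>. \<theta> \<in> \<Theta> \<Longrightarrow> C1_regular (\<lambda>x. F x \<theta>)"
    and "\<And>\<theta>. \<theta> \<in> \<Theta> \<Longrightarrow> C1_regular (\<lambda>x. a x \<theta>)"
    and "N \<ge> 1"
    and "\<And>j. j \<in> {1..N} \<Longrightarrow> \<theta> j \<in> \<Theta>"
    and "\<And>j. j \<in> {1..N} \<Longrightarrow> \<alpha> j > 0"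
    and "(\<Sum>j=1..N. \<alpha> j) = 1"
  shows "(\<forall>u. J u = (\<Sum>j=1..N. \<alpha> j * a (trajectory F0 F x0 (\<theta> j) u 1) (\<theta> j)) + \<beta> / 2 * (norm u)\<^sup>2) \<and>
    (\<forall>u. gateaux_differentiable J u) \<and>
    (\<exists>!G. gradient_field J G) \<and>
    (\<forall>u. \<forall>j\<in>{1..N}. \<exists>!p. is_adjoint_curve F0 F x0 a (\<theta> j) u p) \<and>
    (\<forall>G. gradient_field J G \<longrightarrow>
      (\<forall>u. AE t in lebesgue_on {0..1}.
        rep_L2 (G u) t =
          (\<Sum>j=1..N. \<alpha> j *\<^sub>R
             (transpose (F (trajectory F0 F x0 (\<theta> j) u t) (\<theta> j)) *v adjoint_curve F0 F x0 a (\<theta> j) u t))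
          + \<beta> *\<^sub>R rep_L2 u t))"
proof -
  let ?x = "\<lambda>\<theta>. trajectory F0 F x0 \<theta>"
  have smooth: "smooth_control F0 F (\<theta> j) L a" if "j \<in> {1..N}" for j
    using assms(3) assms(4)[of "\<theta> j" "\<theta> j"] assms(5)[of "\<theta> j" "\<theta> j"] assms(10-12,14) that
    by unfold_locales auto
  define s where "s = (\<lambda>j u t. transpose (F (?x (\<theta> j) u t) (\<theta> j)) *v adjoint_curve F0 F x0 a (\<theta> j) u t)"
  have s: "continuous_on {0..1} (s j u)"
      "((\<lambda>h. (a (?x (\<theta> j) (u + h *\<^sub>R v) 1) (\<theta> j) - a (?x (\<theta> j) u 1) (\<theta> j)) / h)
        \<longlongrightarrow> integral {0..1} (\<lambda>t. s j u t \<bullet> rep_L2 v t)) (at 0)" if "j \<in> {1..N}" for j u v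
  proof -
    interpret smooth_control F0 F "\<theta> j" L x0 a by (rule smooth[OF that])
    have "s j u = switching u" by (simp add: s_def switching_def fun_eq_iff)
    then show "continuous_on {0..1} (s j u)"
      "((\<lambda>h. (a (?x (\<theta> j) (u + h *\<^sub>R v) 1) (\<theta> j) - a (?x (\<theta> j) u 1) (\<theta> j)) / h)
        \<longlongrightarrow> integral {0..1} (\<lambda>t. s j u t \<bullet> rep_L2 v t)) (at 0)"
      using continuous_switching terminal_cost_derivative by simp_all
  qed
  have J: "J u = (\<Sum>j=1..N. \<alpha> j * a (?x (\<theta> j) u 1) (\<theta> j)) + \<beta> / 2 * (norm u)\<^sup>2" for u
  proof -
    \<comment> \<open>Continuity on \<Theta> makes the integrand Borel, so that the integral against
      the empirical measure is the finite sum.\<close>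
    have "continuous_on \<Theta> (\<lambda>\<theta>. ?x \<theta> u 1)"
      using assms(3-6) by (intro trajectory_continuous_in_parameter[where L = L]) auto
    then have "continuous_on \<Theta> (\<lambda>\<theta>. a (?x \<theta> u 1) \<theta>)"
      using continuous_on_compose2[OF assms(7), of \<Theta> "\<lambda>\<theta>. (?x \<theta> u 1, \<theta>)"]
      by (force intro: continuous_on_Pair continuous_on_id)
    from integral_empirical_measure[OF _ _ borel_measurable_continuous_on_restrict[OF this], of N \<theta> \<alpha>]
    show ?thesis
      using assms(14,15) unfolding J_def ensemble_cost_def by (simp add: less_imp_le)
  qed
  \<comment> \<open>The asserted formula for the gradient, as a function; \<open>G\<close> is its
    class.\<close>
  define \<gamma> where "\<gamma> = (\<lambda>u t. (\<Sum>j=1..N. \<alpha> j *\<^sub>R s j u t) + \<beta> *\<^sub>R rep_L2 u t)"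
  have \<gamma>: "square_integrable (\<gamma> u)" for u
    unfolding \<gamma>_def
    by (intro square_integrable_add square_integrable_scaleR square_integrable_rep_L2
        square_integrable_continuous continuous_on_sum continuous_on_scaleR continuous_on_const s)
  define G where "G = (\<lambda>u. abs_L2 (\<gamma> u))"
  have inner: "G u \<bullet> v = (\<Sum>j=1..N. \<alpha> j * integral {0..1} (\<lambda>t. s j u t \<bullet> rep_L2 v t)) + \<beta> * (u \<bullet> v)" for u v
  proof -
    have int: "(\<lambda>t. f t \<bullet> rep_L2 v t) integrable_on {0..1}" if "square_integrable f" for f
      using that by (intro integrable_on_lebesgue_on square_integrable_inner square_integrable_rep_L2) auto
    have "G u \<bullet> v = integral {0..1} (\<lambda>t. \<gamma> u t \<bullet> rep_L2 v t)"
      unfolding G_def by (rule inner_abs_L2[OF \<gamma>])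
    also have "\<dots> = integral {0..1} (\<lambda>t. (\<Sum>j=1..N. \<alpha> j * (s j u t \<bullet> rep_L2 v t)) + \<beta> * (rep_L2 u t \<bullet> rep_L2 v t))"
      by (simp add: \<gamma>_def inner_add_left inner_sum_left)
    also have "((\<lambda>t. (\<Sum>j=1..N. \<alpha> j * (s j u t \<bullet> rep_L2 v t)) + \<beta> * (rep_L2 u t \<bullet> rep_L2 v t)) has_integral
        (\<Sum>j=1..N. \<alpha> j * integral {0..1} (\<lambda>t. s j u t \<bullet> rep_L2 v t)) + \<beta> * (u \<bullet> v)) {0..1}"
      unfolding inner_L2_eq_integral
      by (intro has_integral_add has_integral_sum has_integral_mult_right integrable_integral int
          square_integrable_continuous s square_integrable_rep_L2) auto
    then have "integral {0..1} (\<lambda>t. (\<Sum>j=1..N. \<alpha> j * (s j u t \<bullet> rep_L2 v t)) + \<beta> * (rep_L2 u t \<bullet> rep_L2 v t)) =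
        (\<Sum>j=1..N. \<alpha> j * integral {0..1} (\<lambda>t. s j u t \<bullet> rep_L2 v t)) + \<beta> * (u \<bullet> v)"
      by (rule integral_unique)
    finally show ?thesis .
  qed
  have derivative: "has_gateaux_derivative J (\<lambda>v. G u \<bullet> v) u" for u
    unfolding has_gateaux_derivative_def
  proof (intro conjI allI bounded_linear_inner_right)
    fix v
    have "((\<lambda>h. (\<Sum>j=1..N. \<alpha> j * ((a (?x (\<theta> j) (u + h *\<^sub>R v) 1) (\<theta> j) - a (?x (\<theta> j) u 1) (\<theta> j)) / h))
          + \<beta> / 2 * (((norm (u + h *\<^sub>R v))\<^sup>2 - (norm u)\<^sup>2) / h))
        \<longlongrightarrow> (\<Sum>j=1..N. \<alpha> j * integral {0..1} (\<lambda>t. s j u t \<bullet> rep_L2 v t)) + \<beta> / 2 * (2 * (u \<bullet> v))) (at 0)"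
      by (intro tendsto_add tendsto_sum tendsto_mult_left s norm_square_directional_derivative)
    then show "((\<lambda>h. (J (u + h *\<^sub>R v) - J u) / h) \<longlongrightarrow> G u \<bullet> v) (at 0)"
      by (simp add: J inner diff_divide_distrib add_divide_distrib right_diff_distrib sum_subtractf
          sum_divide_distrib algebra_simps)
  qed
  note gradient = gradient_field_unique_iff[of J G, OF derivative]
  show ?thesis
  proof (intro conjI allI impI ballI)
    show "J u = (\<Sum>j=1..N. \<alpha> j * a (?x (\<theta> j) u 1) (\<theta> j)) + \<beta> / 2 * (norm u)\<^sup>2" for u by (rule J)
    show "gateaux_differentiable J u" for u
      using derivative unfolding gateaux_differentiable_def by blast
    show "\<exists>!G. gradient_field J G"
      unfolding gradient by simp
    show "\<exists>!p. is_adjoint_curve F0 F x0 a (\<theta> j) u p" if "j \<in> {1..N}" for j u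
      using smooth_control.adjoint_curve_exists_unique[OF smooth[OF that]] .
    show "AE t in lebesgue_on {0..1}. rep_L2 (G' u) t =
        (\<Sum>j=1..N. \<alpha> j *\<^sub>R (transpose (F (?x (\<theta> j) u t) (\<theta> j)) *v adjoint_curve F0 F x0 a (\<theta> j) u t))
          + \<beta> *\<^sub>R rep_L2 u t" if "gradient_field J G'" for G' u
      \<comment> \<open>Every gradient field is \<open>G\<close>, and the representative of its
        value agrees with \<open>\<gamma> u\<close> almost everywhere.\<close>
      using rep_L2_abs_L2[OF \<gamma>[of u]] that unfolding gradient by (simp add: G_def \<gamma>_def s_def)
  qed
qed

end
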